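(* Let $(G,c)$ be an infinite resistance network and let $x,y$ be distinct vertices. The boundary resistance is equal to $$R^{\mathrm{bd}}(x,y)=\frac{R^W(x,y)\,R^F(x,y)}{R^{\mathrm{ha}}(x,y)}.$$ In particular, the resistance across the boundary is infinite (i.e. $R^{\mathrm{bd}}(x,y)=\infty$) if $\operatorname{Harm}=0$.
   Context: A resistance network $(G,c)$ is a connected graph with vertex set $G^0$ and a conductance function $c:G^0\times G^0\to[0,\infty)$ with $c_{xy}=c_{yx}$, $c_{xx}=0$, where $x\sim y$ iff $c_{xy}>0$, and $c(x):=\sum_{y\sim x}c_{xy}<\infty$ for every vertex $x$ (vertices of infinite degree are allowed). Connected means that any two vertices are joined by a finite path of edges. All functions are real-valued. The Laplacian is $(\Delta v)(x)=\sum_{y\sim x}c_{xy}(v(x)-v(y))$. The energy is $\mathcal{E}(u)=\frac12\sum_{x,y\in G^0}c_{xy}(u(x)-u(y))^2$. The energy space $\mathcal{H}_{\mathcal{E}}$ is the space of functions $u:G^0\to\mathbb{R}$ with $\mathcal{E}(u)<\infty$, modulo constants, and $\operatorname{Harm}=\{v\in\mathcal{H}_{\mathcal{E}}:\Delta v(x)=0\text{ for all }x\in G^0\}$. On a finite network $H$, $R_H(x,y)=v(x)-v(y)$, where $v$ is any solution of $\Delta v=\delta_x-\delta_y$ on $H$ ($\delta_x$ is the indicator function of $\{x\}$). An exhaustion $\{G_k\}$ of $G$ is an increasing sequence of finite connected full subgraphs with union $G$ (full: containing all edges of $G$ between its vertices, with the same conductances). $G_k^F$ is this full subnetwork. $G_k^W$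 is the network with vertex set $G_k^0\cup\{\infty_k\}$, all edges of $G_k$ with the same conductances, and for each $x\in G_k^0$ with a neighbour outside $G_k$ an edge from $x$ to $\infty_k$ of conductance $\sum_{y\sim x,\,y\notin G_k}c_{xy}$. The free and wired resistances are $R^F(x,y):=\lim_kR_{G_k^F}(x,y)$ and $R^W(x,y):=\lim_kR_{G_k^W}(x,y)$, for any exhaustion with $x,y\in G_k$ for all $k$ (limits independent of the exhaustion). The harmonic resistance is $R^{\mathrm{ha}}(x,y):=R^F(x,y)-R^W(x,y)$ and the boundary resistance is $R^{\mathrm{bd}}(x,y):=\dfrac{1}{R^W(x,y)^{-1}-R^F(x,y)^{-1}}$. Division of a positive number by $0$ is read as $\infty$. *)

theory Defs
  imports "HOL-Analysis.Analysis"
begin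

text \<open>
  A network is a vertex set \<open>V\<close> with a conductance function \<open>c\<close>; values of \<open>c\<close> and of functions
  on the vertices outside \<open>V\<close> are irrelevant. Two vertices are adjacent iff their conductance is
  positive, so \<open>(K, c)\<close> with \<open>K \<subseteq> V\<close> is the full subnetwork on \<open>K\<close>.
\<close>

definition nbrs :: "'a set \<Rightarrow> ('a \<Rightarrow> 'a \<Rightarrow> real) \<Rightarrow> 'a \<Rightarrow> 'a set" where
  "nbrs V c x = {y \<in> V. c x y > 0}"

definition connected_network :: "'a set \<Rightarrow> ('a \<Rightarrow> 'a \<Rightarrow> real) \<Rightarrow> bool" where
  "connected_network V c \<longleftrightarrow>
     (\<forall>x\<in>V. \<forall>y\<in>V. (x, y) \<in> {(a, b). a \<in> V \<and> b \<in> nbrs V c a}\<^sup>*)"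

locale resistance_network =
  fixes V :: "'a set" and c :: "'a \<Rightarrow> 'a \<Rightarrow> real"
  assumes cond_nonneg: "\<lbrakk>x \<in> V; y \<in> V\<rbrakk> \<Longrightarrow> 0 \<le> c x y"
    and cond_sym: "\<lbrakk>x \<in> V; y \<in> V\<rbrakk> \<Longrightarrow> c x y = c y x"
    and cond_diag: "x \<in> V \<Longrightarrow> c x x = 0"
    and cond_summable: "x \<in> V \<Longrightarrow> c x summable_on nbrs V c x"
    and connected: "connected_network V c"

text \<open>
  The sum defining the Laplacian converges absolutely for every function of finite energy (by the
  Cauchy--Schwarz inequality and \<open>cond_summable\<close>) and is a finite sum on a finite network; the
  default value 0 of a divergent \<open>infsum\<close> therefore plays no role below.
\<close>

definition laplacian :: "'a set \<Rightarrow> ('a \<Rightarrow> 'a \<Rightarrow> real) \<Rightarrow> ('a \<Rightarrow> real) \<Rightarrow> 'a \<Rightarrow> real" where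
  "laplacian V c v x = (\<Sum>\<^sub>\<infinity>y\<in>nbrs V c x. c x y * (v x - v y))"

definition energy :: "'a set \<Rightarrow> ('a \<Rightarrow> 'a \<Rightarrow> real) \<Rightarrow> ('a \<Rightarrow> real) \<Rightarrow> ennreal" where
  "energy V c u = (\<Sum>\<^sub>\<infinity>(x, y)\<in>V \<times> V. ennreal (c x y * (u x - u y)\<^sup>2)) / 2"

text \<open>
  Elements of the energy space are equivalence classes of functions. The relation also identifies
  functions that agree on \<open>V\<close>, so each class is a function on \<open>V\<close> modulo constants.
\<close>

definition mod_const :: "'a set \<Rightarrow> (('a \<Rightarrow> real) \<times> ('a \<Rightarrow> real)) set" where
  "mod_const V = {(u, v). \<exists>k. \<forall>x\<in>V. u x = v x + k}"

definition energy_space :: "'a set \<Rightarrow> ('a \<Rightarrow> 'a \<Rightarrow> real) \<Rightarrow> ('a \<Rightarrow> real) set set" where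
  "energy_space V c = {u. energy V c u < \<infinity>} // mod_const V"

definition energy_zero :: "'a set \<Rightarrow> ('a \<Rightarrow> real) set" where
  "energy_zero V = mod_const V `` {\<lambda>_. 0}"

definition Harm :: "'a set \<Rightarrow> ('a \<Rightarrow> 'a \<Rightarrow> real) \<Rightarrow> ('a \<Rightarrow> real) set set" where
  "Harm V c = {C \<in> energy_space V c. \<forall>v\<in>C. \<forall>x\<in>V. laplacian V c v x = 0}"

text \<open>Only meaningful on a finite connected network, where the value exists and is unique.\<close>

definition finite_resistance :: "'a set \<Rightarrow> ('a \<Rightarrow> 'a \<Rightarrow> real) \<Rightarrow> 'a \<Rightarrow> 'a \<Rightarrow> real" where
  "finite_resistance V c x y =
     (THE r. \<exists>v. (\<forall>z\<in>V. laplacian V c v z = indicator {x} z - indicator {y} z) \<and> r = v x - v y)"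

definition exhaustion :: "'a set \<Rightarrow> ('a \<Rightarrow> 'a \<Rightarrow> real) \<Rightarrow> (nat \<Rightarrow> 'a set) \<Rightarrow> bool" where
  "exhaustion V c K \<longleftrightarrow>
     (\<forall>k. finite (K k) \<and> connected_network (K k) c) \<and> incseq K \<and> (\<Union>k. K k) = V"

text \<open>The wired network on a finite \<open>K \<subseteq> V\<close>; the added vertex at infinity is \<open>None\<close>.\<close>

definition wired_vertices :: "'a set \<Rightarrow> 'a option set" where
  "wired_vertices K = insert None (Some ` K)"

fun wired_cond ::
  "'a set \<Rightarrow> ('a \<Rightarrow> 'a \<Rightarrow> real) \<Rightarrow> 'a set \<Rightarrow> 'a option \<Rightarrow> 'a option \<Rightarrow> real" where
  "wired_cond V c K (Some x) (Some y) = c x y"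
| "wired_cond V c K (Some x) None = (\<Sum>\<^sub>\<infinity>y\<in>nbrs V c x - K. c x y)"
| "wired_cond V c K None (Some x) = (\<Sum>\<^sub>\<infinity>y\<in>nbrs V c x - K. c x y)"
| "wired_cond V c K None None = 0"

text \<open>
  The free and wired resistances are the common limits along all exhaustions whose members
  contain \<open>x\<close> and \<open>y\<close>.
\<close>

definition free_resistance :: "'a set \<Rightarrow> ('a \<Rightarrow> 'a \<Rightarrow> real) \<Rightarrow> 'a \<Rightarrow> 'a \<Rightarrow> real" where
  "free_resistance V c x y =
     (THE r. \<forall>K. exhaustion V c K \<and> (\<forall>k. x \<in> K k \<and> y \<in> K k) \<longrightarrow>
        (\<lambda>k. finite_resistance (K k) c x y) \<longlonglongrightarrow> r)"

definition wired_resistance :: "'a set \<Rightarrow> ('a \<Rightarrow> 'a \<Rightarrow> real) \<Rightarrow> 'a \<Rightarrow> 'a \<Rightarrow> real" where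
  "wired_resistance V c x y =
     (THE r. \<forall>K. exhaustion V c K \<and> (\<forall>k. x \<in> K k \<and> y \<in> K k) \<longrightarrow>
        (\<lambda>k. finite_resistance (wired_vertices (K k)) (wired_cond V c (K k)) (Some x) (Some y))
          \<longlonglongrightarrow> r)"

definition harmonic_resistance :: "'a set \<Rightarrow> ('a \<Rightarrow> 'a \<Rightarrow> real) \<Rightarrow> 'a \<Rightarrow> 'a \<Rightarrow> real" where
  "harmonic_resistance V c x y = free_resistance V c x y - wired_resistance V c x y"

text \<open>The outer division is in \<open>ereal\<close>, where \<open>1 / 0 = \<infinity>\<close>.\<close>

definition boundary_resistance :: "'a set \<Rightarrow> ('a \<Rightarrow> 'a \<Rightarrow> real) \<Rightarrow> 'a \<Rightarrow> 'a \<Rightarrow> ereal" where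
  "boundary_resistance V c x y =
     1 / ereal (inverse (wired_resistance V c x y) - inverse (free_resistance V c x y))"

end

theory Submission
  imports Defs
begin

text \<open>
  Everything is expressed through the energy form
  \<open>E(u, v) = 1/2 \<Sum> c\<^sub>a\<^sub>b (u a - u b) (v a - v b)\<close>, for which \<open>E(u, \<delta>\<^sub>z)\<close> is the Laplacian of \<open>u\<close> at \<open>z\<close>.
  On a finite network the effective conductance \<open>C\<close> between \<open>x\<close> and \<open>y\<close> is the least energy of a
  function with values in \<open>[0, 1]\<close> that is \<open>1\<close> at \<open>x\<close> and \<open>0\<close> at \<open>y\<close>; a minimiser \<open>u\<close>, the unit
  potential, satisfies \<open>E(u, f) = C (f x - f y)\<close> for all \<open>f\<close>, and the resistance is \<open>1 / C\<close>
  (\<open>obtain_unit_potential\<close>, \<open>finite_resistance_eq\<close>).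

  For a finite connected \<open>K\<close> containing \<open>x\<close> and \<open>y\<close>, functions on the wired network of \<open>K\<close> are the same as
  functions on \<open>V\<close> that are constant off \<open>K\<close>, with the same energy (\<open>form_unwire\<close>). So the wired
  conductance is the least energy on \<open>V\<close> among such functions and decreases as \<open>K\<close> grows, because
  more functions qualify, whereas the free conductance increases, because more edges are counted; each
  free conductance is at most each wired one. Along every exhaustion they therefore converge to the supremum \<open>C\<^sup>F\<close> and the
  infimum \<open>C\<^sup>W\<close>, with \<open>0 < C\<^sup>F \<le> C\<^sup>W\<close>, and the two resistances are the positive
  numbers \<open>1 / C\<^sup>F\<close> and \<open>1 / C\<^sup>W\<close>. This gives the formula for the boundary resistance; when
  the two resistances agree, both sides are a positive number divided by \<open>0\<close>.

  For the second claim a unit potential is found on all of \<open>V\<close> for each of the two limits. The free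
  one exists by compactness of \<open>[0, 1]\<close>-valued functions under pointwise convergence, has energy at
  most \<open>C\<^sup>F\<close>, and is extremal, hence represents \<open>f \<mapsto> C\<^sup>F (f x - f y)\<close>. The wired one is the limit in
  energy of the wired unit potentials, which are Cauchy because
  \<open>E(u\<^sub>M - u\<^sub>L, u\<^sub>M - u\<^sub>L) = C\<^sub>L - C\<^sub>M\<close> for \<open>L \<subseteq> M\<close>. Dividing each potential by its conductance gives two
  functions of finite energy with Laplacian \<open>\<delta>\<^sub>x - \<delta>\<^sub>y\<close>. Their difference is harmonic, so it is
  constant if \<open>Harm = 0\<close>; comparing its values at \<open>x\<close> and \<open>y\<close> yields \<open>1 / C\<^sup>F = 1 / C\<^sup>W\<close>.
\<close>

section \<open>The energy form\<close>

definition finite_energy :: "'a set \<Rightarrow> ('a \<Rightarrow> 'a \<Rightarrow> real) \<Rightarrow> ('a \<Rightarrow> real) \<Rightarrow> bool" where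
  "finite_energy V c u \<longleftrightarrow> (\<lambda>(a, b). c a b * (u a - u b)\<^sup>2) summable_on V \<times> V"

text \<open>
  The factor \<open>1/2\<close> compensates for every edge being counted in both directions. The value is
  meaningful for arguments of finite energy, for which the sum converges absolutely.
\<close>

definition energy_form ::
  "'a set \<Rightarrow> ('a \<Rightarrow> 'a \<Rightarrow> real) \<Rightarrow> ('a \<Rightarrow> real) \<Rightarrow> ('a \<Rightarrow> real) \<Rightarrow> real" where
  "energy_form V c u v = (\<Sum>\<^sub>\<infinity>(a, b)\<in>V \<times> V. c a b * ((u a - u b) * (v a - v b))) / 2"

lemma energy_form_commute: "energy_form V c u v = energy_form V c v u"
  by (simp add: energy_form_def mult.commute mult.left_commute)

lemma finite_energy_finite: "finite V \<Longrightarrow> finite_energy V c u"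
  by (simp add: finite_energy_def)

lemma finite_energy_cong:
  assumes "\<And>a. a \<in> V \<Longrightarrow> u a = u' a + k"
  shows "finite_energy V c u \<longleftrightarrow> finite_energy V c u'"
  unfolding finite_energy_def using assms by (intro summable_on_cong) auto

lemma energy_form_cong:
  assumes "\<And>a. a \<in> V \<Longrightarrow> u a = u' a + k" and "\<And>a. a \<in> V \<Longrightarrow> v a = v' a + l"
  shows "energy_form V c u v = energy_form V c u' v'"
  unfolding energy_form_def using assms by (intro arg_cong[where f="\<lambda>s. s / 2"] infsum_cong) auto

lemma quadratic_nonneg_imp_discriminant:
  fixes p q r :: real
  assumes "\<And>t. 0 \<le> p + 2 * t * q + t\<^sup>2 * r" and "0 \<le> r"
  shows "q\<^sup>2 \<le> p * r"
proof (cases "r = 0")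
  case True
  have "q = 0"
  proof (rule ccontr)
    assume "q \<noteq> 0"
    then have "p + 2 * (- (p + 1) / (2 * q)) * q = - 1" by (simp add: field_simps)
    then show False
      using assms(1)[of "- (p + 1) / (2 * q)"] True by simp
  qed
  then show ?thesis using True by simp
next
  case False
  then have r: "0 < r" using assms(2) by simp
  have "0 \<le> p + 2 * (- q / r) * q + (- q / r)\<^sup>2 * r" by (rule assms)
  also have "\<dots> = (p * r - q\<^sup>2) / r"
    using False by (simp add: field_simps power2_eq_square)
  finally show ?thesis using r by (simp add: zero_le_divide_iff)
qed

text \<open>
  Connectivity enters only through paths between two given vertices, which
  makes subsets of \<open>V\<close> and wired networks instances by conductance properties alone.
\<close>

locale conductances =
  fixes V :: "'a set" and c :: "'a \<Rightarrow> 'a \<Rightarrow> real"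
  assumes nonneg: "\<lbrakk>a \<in> V; b \<in> V\<rbrakk> \<Longrightarrow> 0 \<le> c a b"
    and sym: "\<lbrakk>a \<in> V; b \<in> V\<rbrakk> \<Longrightarrow> c a b = c b a"
    and summable: "a \<in> V \<Longrightarrow> c a summable_on V"
begin

abbreviation fin where "fin \<equiv> finite_energy V c"
abbreviation form where "form \<equiv> energy_form V c"

text \<open>
  The terms are dominated by those of the two energies, since \<open>2 \<bar>s t\<bar> \<le> s\<^sup>2 + t\<^sup>2\<close>.
\<close>

lemma form_summable:
  assumes "fin u" "fin v"
  shows "(\<lambda>(a, b). c a b * ((u a - u b) * (v a - v b))) summable_on V \<times> V"
proof -
  have "(\<lambda>e. (case e of (a, b) \<Rightarrow> c a b * (u a - u b)\<^sup>2) + (case e of (a, b) \<Rightarrow> c a b * (v a - v b)\<^sup>2))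
      summable_on V \<times> V"
    using assms unfolding finite_energy_def by (rule summable_on_add)
  then have "(\<lambda>(a, b). \<bar>c a b * ((u a - u b) * (v a - v b))\<bar>) summable_on V \<times> V"
  proof (rule summable_on_comparison_test)
    fix e assume "e \<in> V \<times> V"
    then obtain a b where e: "e = (a, b)" and ab: "a \<in> V" "b \<in> V" by blast
    have "2 * \<bar>(u a - u b) * (v a - v b)\<bar> \<le> (u a - u b)\<^sup>2 + (v a - v b)\<^sup>2"
      using zero_le_power2[of "\<bar>u a - u b\<bar> - \<bar>v a - v b\<bar>"]
      by (simp add: power2_diff abs_mult)
    then have "\<bar>(u a - u b) * (v a - v b)\<bar> \<le> (u a - u b)\<^sup>2 + (v a - v b)\<^sup>2" by linarith
    from mult_left_mono[OF this nonneg[OF ab]]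
    show "(case e of (a, b) \<Rightarrow> \<bar>c a b * ((u a - u b) * (v a - v b))\<bar>)
        \<le> (case e of (a, b) \<Rightarrow> c a b * (u a - u b)\<^sup>2) + (case e of (a, b) \<Rightarrow> c a b * (v a - v b)\<^sup>2)"
      using nonneg[OF ab] by (simp add: e abs_mult distrib_left)
  qed auto
  then show ?thesis by (rule abs_summable_summable[OF back_subst[where P="\<lambda>f. f summable_on _"]]) (simp add: case_prod_unfold)
qed

lemma fin_scale: "fin u \<Longrightarrow> fin (\<lambda>a. t * u a)"
  unfolding finite_energy_def
  by (drule summable_on_cmult_right[where c="t\<^sup>2"], erule back_subst[where P="\<lambda>f. f summable_on _"])
     (auto simp: fun_eq_iff power_mult_distrib right_diff_distrib[symmetric])

lemma fin_add: assumes "fin u" "fin v" shows "fin (\<lambda>a. u a + v a)"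
proof -
  have "(\<lambda>e. ((case e of (a, b) \<Rightarrow> c a b * (u a - u b)\<^sup>2) + (case e of (a, b) \<Rightarrow> c a b * (v a - v b)\<^sup>2))
      + 2 * (case e of (a, b) \<Rightarrow> c a b * ((u a - u b) * (v a - v b))))
      summable_on V \<times> V"
    using assms form_summable[OF assms] unfolding finite_energy_def
    by (intro summable_on_add summable_on_cmult_right)
  moreover have "c a b * (u a - u b)\<^sup>2 + c a b * (v a - v b)\<^sup>2 + 2 * (c a b * ((u a - u b) * (v a - v b)))
      = c a b * (u a + v a - (u b + v b))\<^sup>2" for a b
  proof -
    have "(u a + v a - (u b + v b))\<^sup>2 = (u a - u b)\<^sup>2 + (v a - v b)\<^sup>2 + 2 * ((u a - u b) * (v a - v b))"
      by (simp add: power2_eq_square algebra_simps)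
    then show ?thesis by (simp only: distrib_left mult.left_commute)
  qed
  ultimately have "(\<lambda>(a, b). c a b * (u a + v a - (u b + v b))\<^sup>2) summable_on V \<times> V"
    by (simp add: case_prod_unfold)
  then show ?thesis unfolding finite_energy_def .
qed

lemma fin_diff: "fin u \<Longrightarrow> fin v \<Longrightarrow> fin (\<lambda>a. u a - v a)"
  using fin_add[of u "\<lambda>a. -1 * v a"] fin_scale[of v "-1"] by simp

lemma form_scale_right: "form u (\<lambda>a. t * v a) = t * form u v"
proof -
  have "(\<Sum>\<^sub>\<infinity>(a, b)\<in>V \<times> V. c a b * ((u a - u b) * (t * v a - t * v b)))
      = (\<Sum>\<^sub>\<infinity>e\<in>V \<times> V. t * (case e of (a, b) \<Rightarrow> c a b * ((u a - u b) * (v a - v b))))"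
    by (intro infsum_cong) (auto simp: algebra_simps)
  then show ?thesis unfolding energy_form_def by (simp only: infsum_cmult_right' times_divide_eq_right)
qed

lemma form_add_right:
  assumes "fin u" "fin v" "fin w"
  shows "form u (\<lambda>a. v a + w a) = form u v + form u w"
proof -
  have "(\<Sum>\<^sub>\<infinity>(a, b)\<in>V \<times> V. c a b * ((u a - u b) * (v a + w a - (v b + w b))))
      = (\<Sum>\<^sub>\<infinity>e\<in>V \<times> V. (case e of (a, b) \<Rightarrow> c a b * ((u a - u b) * (v a - v b)))
           + (case e of (a, b) \<Rightarrow> c a b * ((u a - u b) * (w a - w b))))"
    by (intro infsum_cong) (auto simp: algebra_simps)
  also have "\<dots> = (\<Sum>\<^sub>\<infinity>(a, b)\<in>V \<times> V. c a b * ((u a - u b) * (v a - v b)))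
      + (\<Sum>\<^sub>\<infinity>(a, b)\<in>V \<times> V. c a b * ((u a - u b) * (w a - w b)))"
    by (rule infsum_add[OF form_summable[OF assms(1,2)] form_summable[OF assms(1,3)]])
  finally show ?thesis
    unfolding energy_form_def by (simp only: add_divide_distrib)
qed

lemma form_diff_right:
  assumes "fin u" "fin v" "fin w"
  shows "form u (\<lambda>a. v a - w a) = form u v - form u w"
  using form_add_right[OF assms(1,2) fin_scale[OF assms(3), of "-1"]] form_scale_right[of u "-1" w]
  by simp

lemma form_diff_left:
  assumes "fin u" "fin v" "fin w"
  shows "form (\<lambda>a. v a - w a) u = form v u - form w u"
  using form_diff_right[OF assms] by (simp only: energy_form_commute[of V c u])

lemma form_scale_left: "form (\<lambda>a. t * v a) u = t * form v u"
  by (metis energy_form_commute form_scale_right)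

lemma form_self_nonneg: "0 \<le> form u u"
  unfolding energy_form_def by (auto intro!: divide_nonneg_pos infsum_nonneg simp: nonneg)

lemma form_self_expand:
  assumes "fin u" "fin v"
  shows "form (\<lambda>a. u a + t * v a) (\<lambda>a. u a + t * v a) = form u u + 2 * t * form u v + t\<^sup>2 * form v v"
proof -
  have f: "fin (\<lambda>a. t * v a)" "fin (\<lambda>a. u a + t * v a)"
    using assms by (auto intro: fin_scale fin_add)
  have "form (\<lambda>a. u a + t * v a) (\<lambda>a. u a + t * v a)
      = form (\<lambda>a. u a + t * v a) u + t * form (\<lambda>a. u a + t * v a) v"
    using form_add_right[OF f(2) assms(1) f(1)] form_scale_right[of "\<lambda>a. u a + t * v a" t v]
    by (simp only:)
  also have "form (\<lambda>a. u a + t * v a) u = form u u + t * form u v"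
    using form_add_right[OF assms(1) assms(1) f(1)] form_scale_right[of u t v]
    by (simp only: energy_form_commute[of V c "\<lambda>a. u a + t * v a"])
  also have "form (\<lambda>a. u a + t * v a) v = form u v + t * form v v"
    using form_add_right[OF assms(2) assms(1) f(1)] form_scale_right[of v t v]
    by (simp only: energy_form_commute[of V c "\<lambda>a. u a + t * v a"] energy_form_commute[of V c v u])
  finally show ?thesis by (simp add: power2_eq_square algebra_simps)
qed

lemma form_diff_self:
  assumes "fin u" "fin v"
  shows "form (\<lambda>a. u a - v a) (\<lambda>a. u a - v a) = form u u - 2 * form u v + form v v"
  using form_self_expand[OF assms, of "-1"] by simp

lemma form_Cauchy_Schwarz:
  assumes "fin u" "fin v"
  shows "(form u v)\<^sup>2 \<le> form u u * form v v"
proof (rule quadratic_nonneg_imp_discriminant)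
  show "0 \<le> form u u + 2 * t * form u v + t\<^sup>2 * form v v" for t
    using form_self_nonneg[of "\<lambda>a. u a + t * v a"] unfolding form_self_expand[OF assms] .
qed (rule form_self_nonneg)

text \<open>
  First-order optimality: if \<open>C\<close> bounds the energy from below on unit differences and \<open>u\<close>
  attains the bound, then \<open>E(u + t f, u + t f) - C (1 + t (f x - f y))\<^sup>2\<close> is a nonnegative
  quadratic in \<open>t\<close> that vanishes at \<open>t = 0\<close>, so its linear coefficient is zero. No limit
  has to be exchanged with a sum, which is why this is used on the infinite network as well.
\<close>

lemma extremal_imp_represents:
  assumes "fin u" "u x - u y = 1" "form u u \<le> C" "fin f"
    and bound: "\<And>g. fin g \<Longrightarrow> C * (g x - g y)\<^sup>2 \<le> form g g"
  shows "form u f = C * (f x - f y)"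
proof -
  define d where "d = f x - f y"
  have "0 \<le> (form u u - C) + 2 * t * (form u f - C * d) + t\<^sup>2 * (form f f - C * d\<^sup>2)" for t
  proof -
    have "C * (1 + t * d)\<^sup>2 \<le> form u u + 2 * t * form u f + t\<^sup>2 * form f f"
      using bound[OF fin_add[OF assms(1) fin_scale[OF assms(4), of t]]] assms(2)
      unfolding form_self_expand[OF assms(1,4)]
      by (simp add: d_def algebra_simps)
    then show ?thesis by (simp add: power2_eq_square algebra_simps)
  qed
  then have "(form u f - C * d)\<^sup>2 \<le> (form u u - C) * (form f f - C * d\<^sup>2)"
    by (rule quadratic_nonneg_imp_discriminant) (simp add: bound assms(4) d_def)
  also have "form u u = C" using bound[OF assms(1)] assms(2,3) by simp
  finally show ?thesis by (simp add: d_def)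
qed

text \<open>
  The Cauchy--Schwarz bound for a represented functional, read off from the energy of
  \<open>f - (f x - f y) u\<close>. It is the source of all monotonicity of resistances.
\<close>

lemma represents_imp_bound:
  assumes "fin u" "fin f" "form u u = C" "form u f = C * (f x - f y)"
  shows "C * (f x - f y)\<^sup>2 \<le> form f f"
proof -
  have "0 \<le> form f f + 2 * (- (f x - f y)) * form f u + (- (f x - f y))\<^sup>2 * form u u"
    using form_self_nonneg[of "\<lambda>a. f a + - (f x - f y) * u a"]
    unfolding form_self_expand[OF assms(2,1)] .
  then show ?thesis
    by (simp add: assms(3,4) energy_form_commute[of V c f u] power2_eq_square algebra_simps)
qed

lemma conductances_subset:
  assumes "K \<subseteq> V"
  shows "conductances K c"
proof
  show "c a summable_on K" if "a \<in> K" for a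
    using summable assms that by (meson subsetD summable_on_subset_banach)
qed (use assms in \<open>auto intro!: nonneg sym\<close>)

lemma energy_form_subset_mono:
  assumes "K \<subseteq> L" "L \<subseteq> V" "finite_energy L c u"
  shows "energy_form K c u u \<le> energy_form L c u u"
proof -
  have s: "(\<lambda>(a, b). c a b * ((u a - u b) * (u a - u b))) summable_on L \<times> L"
    using assms(3) by (simp add: finite_energy_def power2_eq_square)
  have pos: "0 \<le> (case e of (a, b) \<Rightarrow> c a b * ((u a - u b) * (u a - u b)))" if "e \<in> L \<times> L" for e
    using that assms(2) by (auto intro!: mult_nonneg_nonneg[OF nonneg zero_le_square])
  have sub: "K \<times> K \<subseteq> L \<times> L" using assms(1) by auto
  have "(\<Sum>\<^sub>\<infinity>(a, b)\<in>K \<times> K. c a b * ((u a - u b) * (u a - u b)))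
      \<le> (\<Sum>\<^sub>\<infinity>(a, b)\<in>L \<times> L. c a b * ((u a - u b) * (u a - u b)))"
    by (rule infsum_mono2[OF summable_on_subset_banach[OF s sub] s sub pos]) blast
  then show ?thesis
    unfolding energy_form_def by (rule divide_right_mono) simp
qed

text \<open>
  Lower semicontinuity of the energy in the form used after a compactness argument: a bound on
  all finite subnetworks is a bound on the whole network.
\<close>

lemma finite_energyI:
  assumes "\<And>S. finite S \<Longrightarrow> S \<subseteq> V \<Longrightarrow> energy_form S c u u \<le> r"
  shows "fin u" and "form u u \<le> r"
proof -
  let ?q = "\<lambda>(a, b). c a b * (u a - u b)\<^sup>2"
  have pos: "0 \<le> ?q e" if "e \<in> V \<times> V" for e
    using that by (auto intro!: mult_nonneg_nonneg nonneg)
  have bound: "sum ?q F \<le> 2 * r" if F: "finite F" "F \<subseteq> V \<times> V" for F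
  proof -
    define S where "S = fst ` F \<union> snd ` F"
    have S: "finite S" "S \<subseteq> V" "F \<subseteq> S \<times> S"
      using F by (auto simp: S_def image_iff) (metis fst_conv, metis snd_conv)
    have "sum ?q F \<le> sum ?q (S \<times> S)"
      by (rule sum_mono2) (use S in \<open>auto intro!: mult_nonneg_nonneg nonneg\<close>)
    also have "\<dots> = 2 * energy_form S c u u"
      using S(1) by (simp add: energy_form_def power2_eq_square)
    also have "\<dots> \<le> 2 * r" using assms[OF S(1,2)] by simp
    finally show ?thesis .
  qed
  have "bdd_above (sum ?q ` {F. F \<subseteq> V \<times> V \<and> finite F})"
    by (rule bdd_aboveI2[where M="2 * r"]) (use bound in blast)
  with pos have s: "?q summable_on V \<times> V" by (rule nonneg_bdd_above_summable_on)
  then show "fin u" unfolding finite_energy_def .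
  have "infsum ?q (V \<times> V) \<le> 2 * r" using s bound by (rule infsum_le_finite_sums)
  then show "form u u \<le> r" by (simp add: energy_form_def power2_eq_square)
qed

lemma energy_finite:
  assumes "fin u"
  shows "energy V c u < \<infinity>"
proof -
  let ?q = "\<lambda>(a, b). c a b * (u a - u b)\<^sup>2"
  have s: "?q summable_on V \<times> V" using assms unfolding finite_energy_def .
  have pos: "0 \<le> ?q e" if "e \<in> V \<times> V" for e
    using that by (auto intro!: mult_nonneg_nonneg nonneg)
  have "(\<Sum>\<^sub>\<infinity>e\<in>V \<times> V. ennreal (?q e)) \<le> ennreal (infsum ?q (V \<times> V))"
  proof (rule infsum_le_finite_sums)
    fix F assume F: "finite F" "F \<subseteq> V \<times> V"
    have "(\<Sum>e\<in>F. ennreal (?q e)) = ennreal (sum ?q F)"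
      using F(2) pos by (intro sum_ennreal) blast
    also have "\<dots> \<le> ennreal (infsum ?q (V \<times> V))"
      using F pos by (intro ennreal_leI finite_sum_le_infsum s) auto
    finally show "(\<Sum>e\<in>F. ennreal (?q e)) \<le> ennreal (infsum ?q (V \<times> V))" .
  qed (rule nonneg_summable_on_complete, simp)
  also have "\<dots> < \<infinity>" by simp
  finally have "(\<Sum>\<^sub>\<infinity>(a, b)\<in>V \<times> V. ennreal (c a b * (u a - u b)\<^sup>2)) < top"
    by (simp add: case_prod_unfold)
  then obtain r where "0 \<le> r" "(\<Sum>\<^sub>\<infinity>(a, b)\<in>V \<times> V. ennreal (c a b * (u a - u b)\<^sup>2)) = ennreal r"
    unfolding less_top_ennreal by blast
  then show ?thesis
    unfolding energy_def using divide_ennreal[of r 2] by simp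
qed

section \<open>The Laplacian and Green's formula\<close>

lemma laplacian_eq_infsum:
  assumes "z \<in> V" shows "laplacian V c v z = (\<Sum>\<^sub>\<infinity>b\<in>V. c z b * (v z - v b))"
  unfolding laplacian_def nbrs_def using nonneg[OF assms]
  by (intro infsum_cong_neutral) (auto simp: order.order_iff_strict)

text \<open>
  The terms of \<open>E(u, \<delta>\<^sub>z)\<close> live on the row and the column of \<open>z\<close> in \<open>V \<times> V\<close>; sums over either
  are sums over \<open>V\<close>.
\<close>

lemma row_and_column_sums:
  fixes g :: "'a \<Rightarrow> real"
  assumes "z \<in> V"
  shows row_summable_iff: "(\<lambda>(a, b). indicator {z} a * g b) summable_on V \<times> V \<longleftrightarrow> g summable_on V"
    and row_infsum: "(\<Sum>\<^sub>\<infinity>(a, b)\<in>V \<times> V. indicator {z} a * g b) = infsum g V"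
    and col_summable_iff: "(\<lambda>(a, b). indicator {z} b * g a) summable_on V \<times> V \<longleftrightarrow> g summable_on V"
    and col_infsum: "(\<Sum>\<^sub>\<infinity>(a, b)\<in>V \<times> V. indicator {z} b * g a) = infsum g V"
proof -
  have inj: "inj_on (Pair z) V" "inj_on (\<lambda>b. (b, z)) V" by (auto simp: inj_on_def)
  have "(\<lambda>(a, b). indicator {z} a * g b) summable_on V \<times> V
      \<longleftrightarrow> (\<lambda>(a, b). g b) summable_on Pair z ` V"
    using assms by (intro summable_on_cong_neutral) (auto simp: indicator_def)
  then show "(\<lambda>(a, b). indicator {z} a * g b) summable_on V \<times> V \<longleftrightarrow> g summable_on V"
    using summable_on_reindex[OF inj(1), of "\<lambda>(a, b). g b"] by (simp add: o_def)
  have "(\<Sum>\<^sub>\<infinity>(a, b)\<in>V \<times> V. indicator {z} a * g b) = infsum (\<lambda>(a, b). g b) (Pair z ` V)"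
    using assms by (intro infsum_cong_neutral) (auto simp: indicator_def)
  then show "(\<Sum>\<^sub>\<infinity>(a, b)\<in>V \<times> V. indicator {z} a * g b) = infsum g V"
    using infsum_reindex[OF inj(1), of "\<lambda>(a, b). g b"] by (simp add: o_def)
  have "(\<lambda>(a, b). indicator {z} b * g a) summable_on V \<times> V
      \<longleftrightarrow> (\<lambda>(a, b). g a) summable_on (\<lambda>b. (b, z)) ` V"
    using assms by (intro summable_on_cong_neutral) (auto simp: indicator_def)
  then show "(\<lambda>(a, b). indicator {z} b * g a) summable_on V \<times> V \<longleftrightarrow> g summable_on V"
    using summable_on_reindex[OF inj(2), of "\<lambda>(a, b). g a"] by (simp add: o_def)
  have "(\<Sum>\<^sub>\<infinity>(a, b)\<in>V \<times> V. indicator {z} b * g a) = infsum (\<lambda>(a, b). g a) ((\<lambda>b. (b, z)) ` V)"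
    using assms by (intro infsum_cong_neutral) (auto simp: indicator_def)
  then show "(\<Sum>\<^sub>\<infinity>(a, b)\<in>V \<times> V. indicator {z} b * g a) = infsum g V"
    using infsum_reindex[OF inj(2), of "\<lambda>(a, b). g a"] by (simp add: o_def)
qed

lemma fin_indicator:
  assumes "z \<in> V"
  shows "fin (indicator {z})"
proof -
  have "(\<lambda>e. (case e of (a, b) \<Rightarrow> indicator {z} a * c z b) + (case e of (a, b) \<Rightarrow> indicator {z} b * c z a))
      summable_on V \<times> V"
    by (intro summable_on_add)
       (simp_all add: row_summable_iff col_summable_iff assms summable)
  then show ?thesis unfolding finite_energy_def
  proof (rule summable_on_comparison_test, clarsimp)
    fix a b assume "a \<in> V" "b \<in> V"
    then show "c a b * (indicator {z} a - indicator {z} b)\<^sup>2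
        \<le> indicator {z} a * c z b + indicator {z} b * c z a"
      using nonneg[of z a] nonneg[of z b] nonneg[of z z] sym[of a z] assms by (auto simp: indicator_def)
  qed (auto simp: nonneg)
qed

text \<open>
  The Laplacian of a function of finite energy converges absolutely even at a vertex of infinite
  degree: \<open>\<bar>t\<bar> \<le> 1 + t\<^sup>2\<close> bounds its terms by those of the total conductance and of the energy.
\<close>

lemma row_diff_summable:
  assumes "fin u" "z \<in> V"
  shows "(\<lambda>b. c z b * (u z - u b)) summable_on V"
proof -
  have q: "(\<lambda>b. c z b * (u z - u b)\<^sup>2) summable_on V"
  proof -
    have "(\<lambda>(a, b). c a b * (u a - u b)\<^sup>2) summable_on Pair z ` V"
      using assms(1) unfolding finite_energy_def
      by (rule summable_on_subset_banach) (use assms(2) in auto)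
    then show ?thesis
      using summable_on_reindex[of "Pair z" V "\<lambda>(a, b). c a b * (u a - u b)\<^sup>2"]
      by (simp add: o_def inj_on_def)
  qed
  have "(\<lambda>b. c z b + c z b * (u z - u b)\<^sup>2) summable_on V"
    by (intro summable_on_add q summable assms)
  then have "(\<lambda>b. \<bar>c z b * (u z - u b)\<bar>) summable_on V"
  proof (rule summable_on_comparison_test)
    fix b assume "b \<in> V"
    then have n: "0 \<le> c z b" using nonneg assms by blast
    have "2 * \<bar>u z - u b\<bar> \<le> 1 + (u z - u b)\<^sup>2"
      using zero_le_power2[of "\<bar>u z - u b\<bar> - 1"] by (simp add: power2_diff)
    then have "\<bar>u z - u b\<bar> \<le> 1 + (u z - u b)\<^sup>2" by (rule order_trans[rotated]) simp
    from mult_left_mono[OF this n]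
    show "\<bar>c z b * (u z - u b)\<bar> \<le> c z b + c z b * (u z - u b)\<^sup>2"
      using n by (simp add: abs_mult distrib_left)
  qed auto
  then show ?thesis by (rule abs_summable_summable[OF back_subst[where P="\<lambda>f. f summable_on _"]]) simp
qed

text \<open>
  Row and column of \<open>z\<close> contribute the same Laplacian sum, which cancels the factor \<open>1/2\<close>.
\<close>

lemma form_indicator:
  assumes "fin u" "z \<in> V"
  shows "form u (indicator {z}) = laplacian V c u z"
proof -
  define g where "g = (\<lambda>b. c z b * (u z - u b))"
  have g: "g summable_on V" unfolding g_def using assms by (rule row_diff_summable)
  have "(\<Sum>\<^sub>\<infinity>(a, b)\<in>V \<times> V. c a b * ((u a - u b) * (indicator {z} a - indicator {z} b)))
    = (\<Sum>\<^sub>\<infinity>e\<in>V \<times> V. (case e of (a, b) \<Rightarrow> indicator {z} a * g b) + (case e of (a, b) \<Rightarrow> indicator {z} b * g a))"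
  proof (intro infsum_cong, clarify)
    fix a b assume ab: "a \<in> V" "b \<in> V"
    have "c a z * (u a - u z) * - 1 = c z a * (u z - u a)"
      using sym[OF ab(1) assms(2)] by (simp add: algebra_simps)
    then show "c a b * ((u a - u b) * (indicator {z} a - indicator {z} b))
        = indicator {z} a * g b + indicator {z} b * g a"
      using sym[OF ab(1) assms(2)] by (cases "a = z"; cases "b = z") (simp_all add: g_def)
  qed
  also have "\<dots> = infsum g V + infsum g V"
    unfolding infsum_add[OF row_summable_iff[OF assms(2), THEN iffD2, OF g]
        col_summable_iff[OF assms(2), THEN iffD2, OF g]]
      row_infsum[OF assms(2)] col_infsum[OF assms(2)] by (rule refl)
  finally have "form u (indicator {z}) = infsum g V"
    unfolding energy_form_def by linarith
  then show ?thesis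
    unfolding laplacian_eq_infsum[OF assms(2)] g_def .
qed

lemma finite_support:
  fixes h :: "'a \<Rightarrow> real"
  assumes "finite K" "K \<subseteq> V"
  shows fin_finite_support: "fin (\<lambda>a. \<Sum>z\<in>K. h z * indicator {z} a)"
    and form_finite_support: "fin u \<Longrightarrow>
      form u (\<lambda>a. \<Sum>z\<in>K. h z * indicator {z} a) = (\<Sum>z\<in>K. h z * laplacian V c u z)"
proof -
  have *: "fin (\<lambda>a. \<Sum>z\<in>K. h z * indicator {z} a) \<and> (fin u \<longrightarrow>
      form u (\<lambda>a. \<Sum>z\<in>K. h z * indicator {z} a) = (\<Sum>z\<in>K. h z * laplacian V c u z))" for u
    using assms
  proof (induction K)
    case empty
    then show ?case by (simp add: finite_energy_def energy_form_def case_prod_unfold)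
  next
    case (insert z K)
    then have z: "z \<in> V" "K \<subseteq> V" by auto
    note split = sum.insert[OF insert(1,2)]
    have fK: "fin (\<lambda>a. \<Sum>z\<in>K. h z * indicator {z} a)"
      and fz: "fin (\<lambda>a. h z * indicator {z} a)"
      using insert.IH z by (auto intro: fin_scale fin_indicator)
    show ?case
    proof (intro conjI impI)
      show "fin (\<lambda>a. \<Sum>z\<in>insert z K. h z * indicator {z} a)"
        unfolding split by (rule fin_add[OF fz fK])
      assume u: "fin u"
      show "form u (\<lambda>a. \<Sum>z\<in>insert z K. h z * indicator {z} a)
          = (\<Sum>z\<in>insert z K. h z * laplacian V c u z)"
        unfolding split form_add_right[OF u fz fK] form_scale_right form_indicator[OF u z(1)]
        using insert.IH z u by simp
    qed
  qed
  show "fin (\<lambda>a. \<Sum>z\<in>K. h z * indicator {z} a)"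
    using * by (rule conjunct1)
  show "form u (\<lambda>a. \<Sum>z\<in>K. h z * indicator {z} a) = (\<Sum>z\<in>K. h z * laplacian V c u z)" if "fin u"
    using conjunct2[OF *] that by (rule mp)
qed

text \<open>
  Green's formula for test functions that are constant off a finite set: up to an additive
  constant, which the form does not see, such a function is a finite combination of indicators.
\<close>

lemma const_off_finite:
  fixes g :: "'a \<Rightarrow> real"
  assumes "finite K" "K \<subseteq> V" "\<And>a. a \<in> V - K \<Longrightarrow> g a = k"
  shows fin_const_off: "fin g"
    and Green: "fin u \<Longrightarrow> form u g = (\<Sum>z\<in>K. (g z - k) * laplacian V c u z)"
proof -
  have g: "g a = (\<Sum>z\<in>K. (g z - k) * indicator {z} a) + k" if "a \<in> V" for a
  proof -
    have "(\<Sum>z\<in>K. (g z - k) * indicator {z} a) = (\<Sum>z\<in>K. if z = a then g a - k else 0)"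
      by (intro sum.cong) (auto simp: indicator_def)
    also have "\<dots> = (if a \<in> K then g a - k else 0)" using assms(1) by (rule sum.delta)
    finally show ?thesis using assms(3) that by (simp split: if_splits)
  qed
  let ?g = "\<lambda>a. \<Sum>z\<in>K. (g z - k) * indicator {z} a"
  show "fin g"
    by (rule iffD2[OF finite_energy_cong[where u'="?g" and k=k] fin_finite_support[OF assms(1,2)]]) (rule g)
  assume u: "fin u"
  have "form u g = form u ?g"
    by (rule energy_form_cong[where k=0 and l=k]) (simp, rule g)
  also have "\<dots> = (\<Sum>z\<in>K. (g z - k) * laplacian V c u z)"
    by (rule form_finite_support[OF assms(1,2) u])
  finally show "form u g = (\<Sum>z\<in>K. (g z - k) * laplacian V c u z)" .
qed

end

section \<open>Unit potentials on finite networks\<close>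

text \<open>
  The bounds \<open>0\<close> and \<open>1\<close> cost nothing, because truncation lowers the energy, and make the set
  compact for pointwise convergence.
\<close>

definition unit_functions :: "'a \<Rightarrow> 'a \<Rightarrow> ('a \<Rightarrow> real) set" where
  "unit_functions x y = {u. (\<forall>z. u z \<in> {0..1}) \<and> u x = 1 \<and> u y = 0}"

lemma continuous_on_eval: "continuous_on UNIV (\<lambda>u :: 'a \<Rightarrow> real. u z)"
  by (rule continuous_on_product_coordinates)

lemma compact_unit_functions: "compact (unit_functions x y)"
proof -
  have "compactin (product_topology (\<lambda>_. euclidean) UNIV) (UNIV \<rightarrow>\<^sub>E {0..1::real})"
    by (simp add: compactin_PiE)
  then have "compact (UNIV \<rightarrow>\<^sub>E {0..1::real} :: ('a \<Rightarrow> real) set)"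
    by (simp add: euclidean_product_topology)
  moreover have "closed {u :: 'a \<Rightarrow> real. u x = 1 \<and> u y = 0}"
    by (intro closed_Collect_conj closed_Collect_eq continuous_on_const continuous_on_eval)
  ultimately have "compact ((UNIV \<rightarrow>\<^sub>E {0..1}) \<inter> {u :: 'a \<Rightarrow> real. u x = 1 \<and> u y = 0})"
    by (rule compact_Int_closed)
  then show ?thesis
    by (rule back_subst[where P=compact]) (auto simp: unit_functions_def PiE_iff)
qed

text \<open>
  Finite intersection property over the directed family of finite subsets of \<open>V\<close>; it replaces
  the choice of a convergent subsequence.
\<close>

lemma compactness_over_finite_sets:
  fixes A :: "'b set \<Rightarrow> ('a \<Rightarrow> real) set"
  assumes closed: "\<And>S. finite S \<Longrightarrow> S \<subseteq> V \<Longrightarrow> closed (A S)"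
    and nonempty: "\<And>S. finite S \<Longrightarrow> S \<subseteq> V \<Longrightarrow> unit_functions x y \<inter> A S \<noteq> {}"
    and anti: "\<And>S T. finite T \<Longrightarrow> T \<subseteq> V \<Longrightarrow> S \<subseteq> T \<Longrightarrow> A T \<subseteq> A S"
  obtains u where "u \<in> unit_functions x y" and "\<And>S. finite S \<Longrightarrow> S \<subseteq> V \<Longrightarrow> u \<in> A S"
proof -
  have "unit_functions x y \<inter> (\<Inter>S\<in>{S. finite S \<and> S \<subseteq> V}. A S) \<noteq> {}"
  proof (rule compact_imp_fip_image[OF compact_unit_functions])
    fix I assume I: "finite I" "I \<subseteq> {S. finite S \<and> S \<subseteq> V}"
    then have "finite (\<Union>I)" "\<Union>I \<subseteq> V" by auto
    then have "unit_functions x y \<inter> A (\<Union>I) \<noteq> {}" "A (\<Union>I) \<subseteq> A S" if "S \<in> I" for S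
      using nonempty anti[of "\<Union>I" S] that by auto
    moreover have "unit_functions x y \<inter> A {} \<noteq> {}" using nonempty[of "{}"] by simp
    ultimately show "unit_functions x y \<inter> (\<Inter>S\<in>I. A S) \<noteq> {}"
      by (cases "I = {}") blast+
  qed (use closed in auto)
  then show ?thesis using that by blast
qed

abbreviation edges :: "'a set \<Rightarrow> ('a \<Rightarrow> 'a \<Rightarrow> real) \<Rightarrow> ('a \<times> 'a) set" where
  "edges K c \<equiv> {(a, b). a \<in> K \<and> b \<in> nbrs K c a}"

context conductances
begin

lemma form_finite:
  assumes "finite V"
  shows "form u v = (\<Sum>a\<in>V. \<Sum>b\<in>V. c a b * ((u a - u b) * (v a - v b))) / 2"
  using assms by (simp add: energy_form_def infsum_finite sum.cartesian_product)

lemma closed_energy_le: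
  assumes "finite S" "S \<subseteq> V"
  shows "closed {u. energy_form S c (\<lambda>a. u a - v a) (\<lambda>a. u a - v a) \<le> r}"
proof -
  interpret S: conductances S c using assms(2) by (rule conductances_subset)
  have "continuous_on UNIV (\<lambda>u. energy_form S c (\<lambda>a. u a - v a) (\<lambda>a. u a - v a))"
    unfolding S.form_finite[OF assms(1)] by (intro continuous_intros continuous_on_eval) auto
  then show ?thesis by (rule closed_Collect_le[OF _ continuous_on_const])
qed

lemma form_contraction:
  assumes "finite V" "\<And>a b. \<bar>u a - u b\<bar> \<le> \<bar>v a - v b\<bar>"
  shows "form u u \<le> form v v"
proof -
  have "(u a - u b) * (u a - u b) \<le> (v a - v b) * (v a - v b)" for a b
    using assms(2)[of a b] abs_le_square_iff[of "u a - u b" "v a - v b"]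
    by (simp add: power2_eq_square)
  then show ?thesis
    unfolding form_finite[OF assms(1)]
    by (intro divide_right_mono sum_mono mult_left_mono nonneg) auto
qed

lemma form_zero_imp_constant:
  assumes "finite V" "form u u = 0" "(x, y) \<in> (edges V c)\<^sup>*"
  shows "u x = u y"
  using assms(3)
proof (induction rule: rtrancl_induct)
  case (step a b)
  then have ab: "a \<in> V" "b \<in> V" "c a b > 0" by (auto simp: nbrs_def)
  have "(\<Sum>a\<in>V. \<Sum>b\<in>V. c a b * ((u a - u b) * (u a - u b))) = 0"
    using assms(2) unfolding form_finite[OF assms(1)] by simp
  then have "(\<Sum>b\<in>V. c a b * ((u a - u b) * (u a - u b))) = 0"
    using ab(1) assms(1) by (subst (asm) sum_nonneg_eq_0_iff) (auto intro!: sum_nonneg simp: nonneg)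
  then have "c a b * ((u a - u b) * (u a - u b)) = 0"
    using ab assms(1) by (subst (asm) sum_nonneg_eq_0_iff) (auto simp: nonneg)
  then show ?case using ab step.IH by simp
qed simp

text \<open>
  A function of least energy among the unit functions exists by compactness. Scaling a function
  with \<open>f x \<noteq> f y\<close> to a unit difference and truncating it to \<open>[0, 1]\<close> shows that the energy of
  every \<open>f\<close> is at least the minimum times \<open>(f x - f y)\<^sup>2\<close>, so the minimiser represents the difference. The path between \<open>x\<close> and \<open>y\<close>
  forces the least energy to be positive.
\<close>

lemma obtain_unit_potential:
  assumes "finite V" "x \<noteq> y" "(x, y) \<in> (edges V c)\<^sup>*"
  obtains u C where "u \<in> unit_functions x y" "0 < C" "\<And>f. form u f = C * (f x - f y)"
proof -
  have fin: "fin f" for f using assms(1) by (rule finite_energy_finite)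
  have cont: "continuous_on (unit_functions x y) (\<lambda>u. form u u)"
    unfolding form_finite[OF assms(1)]
    by (intro continuous_intros continuous_on_subset[OF continuous_on_eval]) auto
  have "indicator {x} \<in> unit_functions x y" using assms(2) by (auto simp: unit_functions_def indicator_def)
  then obtain u where u: "u \<in> unit_functions x y"
    and min: "\<And>v. v \<in> unit_functions x y \<Longrightarrow> form u u \<le> form v v"
    using continuous_attains_inf[OF compact_unit_functions _ cont] by blast
  have xy: "u x = 1" "u y = 0" using u by (auto simp: unit_functions_def)
  have bound: "form u u * (f x - f y)\<^sup>2 \<le> form f f" for f
  proof (cases "f x = f y")
    case False
    define d where "d = f x - f y"
    have d: "d \<noteq> 0" using False by (simp add: d_def)
    define g where "g = (\<lambda>a. (1 / d) * (f a - f y))"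
    define h where "h = (\<lambda>a. max 0 (min 1 (g a)))"
    have "g x = 1" "g y = 0" using d by (auto simp: g_def d_def)
    then have "h \<in> unit_functions x y" by (auto simp: h_def unit_functions_def)
    then have "form u u \<le> form h h" by (rule min)
    also have "\<dots> \<le> form g g"
      by (rule form_contraction[OF assms(1)]) (auto simp: h_def max_def min_def)
    also have "\<dots> = (1 / d)\<^sup>2 * form (\<lambda>a. f a - f y) (\<lambda>a. f a - f y)"
      unfolding g_def form_scale_left form_scale_right by (simp add: power2_eq_square)
    also have "form (\<lambda>a. f a - f y) (\<lambda>a. f a - f y) = form f f"
      by (rule energy_form_cong[where k="- f y" and l="- f y"]) auto
    finally have "form u u * d\<^sup>2 \<le> (1 / d)\<^sup>2 * form f f * d\<^sup>2"
      by (rule mult_right_mono) simp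
    also have "\<dots> = form f f" using d by (simp add: power_divide)
    finally show ?thesis by (simp only: d_def)
  qed (simp add: form_self_nonneg)
  have "form u u \<noteq> 0"
    using form_zero_imp_constant[OF assms(1) _ assms(3), of u] xy by auto
  then have "0 < form u u" using form_self_nonneg[of u] by linarith
  moreover have "form u f = form u u * (f x - f y)" for f
    by (rule extremal_imp_represents[OF fin _ order_refl fin bound]) (simp add: xy)
  ultimately show ?thesis using that u by blast
qed

text \<open>
  For uniqueness, any solution \<open>v\<close> of the defining equation has \<open>C (v x - v y) = E(u, v)\<close>, and
  Green's formula in the other argument evaluates the same number as \<open>u x - u y = 1\<close>.
\<close>

lemma finite_resistance_eq:
  assumes "finite V" "x \<in> V" "y \<in> V" "u x = 1" "u y = 0" "0 < C"
    and repr: "\<And>f. form u f = C * (f x - f y)"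
  shows "finite_resistance V c x y = inverse C"
  unfolding finite_resistance_def
proof (rule the_equality)
  have fin: "fin f" for f using assms(1) by (rule finite_energy_finite)
  have "laplacian V c (\<lambda>a. inverse C * u a) z = indicator {x} z - indicator {y} z" if "z \<in> V" for z
  proof -
    have "laplacian V c (\<lambda>a. inverse C * u a) z = inverse C * (C * (indicator {z} x - indicator {z} y))"
      using form_indicator[OF fin that, symmetric] repr by (simp only: form_scale_left)
    also have "\<dots> = indicator {z} x - indicator {z} y" using assms(6) by simp
    also have "\<dots> = indicator {x} z - indicator {y} z" by (auto simp: indicator_def)
    finally show ?thesis .
  qed
  then show "\<exists>v. (\<forall>z\<in>V. laplacian V c v z = indicator {x} z - indicator {y} z) \<and> inverse C = v x - v y"
    by (intro exI[of _ "\<lambda>a. inverse C * u a"]) (simp add: assms)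
next
  fix r assume "\<exists>v. (\<forall>z\<in>V. laplacian V c v z = indicator {x} z - indicator {y} z) \<and> r = v x - v y"
  then obtain v where v: "\<And>z. z \<in> V \<Longrightarrow> laplacian V c v z = indicator {x} z - indicator {y} z"
    and r: "r = v x - v y" by blast
  have "C * r = form u v" by (simp add: repr r)
  also have "\<dots> = (\<Sum>z\<in>V. (u z - 0) * laplacian V c v z)"
    unfolding energy_form_commute[of V c u v]
    by (rule Green[OF assms(1) order_refl _ finite_energy_finite[OF assms(1)]]) simp
  also have "\<dots> = (\<Sum>z\<in>V. (if z = x then u z else 0) - (if z = y then u z else 0))"
    by (intro sum.cong) (auto simp: v indicator_def)
  also have "\<dots> = 1" using assms by (simp add: sum_subtractf)
  finally show "r = inverse C" using assms(6) by (simp add: field_simps)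
qed

end

section \<open>Wired networks\<close>

text \<open>
  The function on vertices that belongs to a function on the wired network: all vertices off \<open>K\<close>
  take the value of the added vertex.
\<close>

definition unwire :: "'a set \<Rightarrow> ('a option \<Rightarrow> real) \<Rightarrow> 'a \<Rightarrow> real" where
  "unwire K f a = (if a \<in> K then f (Some a) else f None)"

lemma infsum_nbrs_minus:
  assumes "conductances V c" "z \<in> V"
  shows "(\<Sum>\<^sub>\<infinity>b\<in>nbrs V c z - K. c z b) = (\<Sum>\<^sub>\<infinity>b\<in>V - K. c z b)"
  using conductances.nonneg[OF assms]
  by (intro infsum_cong_neutral) (auto simp: nbrs_def order.order_iff_strict)

context conductances
begin

lemma conductances_wired:
  assumes "finite K" "K \<subseteq> V"
  shows "conductances (wired_vertices K) (wired_cond V c K)"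
proof
  have nn: "0 \<le> (\<Sum>\<^sub>\<infinity>b\<in>nbrs V c z - K. c z b)" if "z \<in> K" for z
    by (rule infsum_nonneg) (use that assms(2) nonneg in \<open>auto simp: nbrs_def\<close>)
  show "0 \<le> wired_cond V c K a b" if "a \<in> wired_vertices K" "b \<in> wired_vertices K" for a b
    using that assms(2) by (auto simp: wired_vertices_def intro!: nonneg nn)
  show "wired_cond V c K a b = wired_cond V c K b a" if "a \<in> wired_vertices K" "b \<in> wired_vertices K" for a b
    using that assms(2) by (auto simp: wired_vertices_def intro!: sym)
  show "wired_cond V c K a summable_on wired_vertices K" for a
    using assms(1) by (simp add: wired_vertices_def)
qed

lemma fin_unwire:
  assumes "finite K" "K \<subseteq> V"
  shows "fin (unwire K f)"
  by (rule fin_const_off[OF assms]) (simp add: unwire_def)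

text \<open>
  The edges from \<open>z\<close> to vertices off \<open>K\<close> all see the same difference, so their conductances add up to
  that of the edge to the added vertex.
\<close>

lemma laplacian_unwire:
  assumes "finite K" "K \<subseteq> V" "z \<in> K"
  shows "laplacian V c (unwire K f) z = laplacian (wired_vertices K) (wired_cond V c K) f (Some z)"
proof -
  have z: "z \<in> V" using assms by auto
  have fu: "fin (unwire K f)" using assms(1,2) by (rule fin_unwire)
  define g where "g = (\<lambda>b. c z b * (unwire K f z - unwire K f b))"
  have s: "g summable_on K" "g summable_on V - K"
    using row_diff_summable[OF fu z] unfolding g_def[symmetric]
    by (rule summable_on_subset_banach; use assms(2) in auto)+
  have "laplacian V c (unwire K f) z = infsum g (K \<union> (V - K))"
    using assms(2) unfolding laplacian_eq_infsum[OF z] g_def by (simp add: Un_absorb1)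
  also have "\<dots> = infsum g K + infsum g (V - K)"
    by (rule infsum_Un_disjoint[OF s]) auto
  also have "infsum g K = (\<Sum>b\<in>K. c z b * (f (Some z) - f (Some b)))"
    using assms by (simp add: g_def unwire_def)
  also have "infsum g (V - K) = (\<Sum>\<^sub>\<infinity>b\<in>V - K. c z b * (f (Some z) - f None))"
    by (intro infsum_cong) (use assms in \<open>auto simp: g_def unwire_def\<close>)
  also have "\<dots> = (\<Sum>\<^sub>\<infinity>b\<in>V - K. c z b) * (f (Some z) - f None)"
    by (rule infsum_cmult_left')
  finally have 1: "laplacian V c (unwire K f) z = (\<Sum>b\<in>K. c z b * (f (Some z) - f (Some b)))
      + (\<Sum>\<^sub>\<infinity>b\<in>V - K. c z b) * (f (Some z) - f None)" .
  interpret W: conductances "wired_vertices K" "wired_cond V c K"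
    using assms(1,2) by (rule conductances_wired)
  have "laplacian (wired_vertices K) (wired_cond V c K) f (Some z)
      = (\<Sum>b\<in>wired_vertices K. wired_cond V c K (Some z) b * (f (Some z) - f b))"
    using assms by (subst W.laplacian_eq_infsum) (auto simp: wired_vertices_def)
  also have "\<dots> = (\<Sum>\<^sub>\<infinity>b\<in>V - K. c z b) * (f (Some z) - f None) + (\<Sum>b\<in>K. c z b * (f (Some z) - f (Some b)))"
    using assms infsum_nbrs_minus[OF conductances_axioms z, of K]
    by (simp add: wired_vertices_def sum.reindex)
  finally show ?thesis using 1 by simp
qed

text \<open>
  Both sides equal the same finite sum by Green's formula, because the Laplacians agree on \<open>K\<close>;
  this avoids splitting the double sum over \<open>V \<times> V\<close>.
\<close>

lemma form_unwire:
  assumes "finite K" "K \<subseteq> V"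
  shows "form (unwire K f) (unwire K g) = energy_form (wired_vertices K) (wired_cond V c K) f g"
proof -
  interpret W: conductances "wired_vertices K" "wired_cond V c K"
    using assms by (rule conductances_wired)
  have fin: "finite (wired_vertices K)" using assms(1) by (simp add: wired_vertices_def)
  have "W.form f g = (\<Sum>z\<in>Some ` K. (g z - g None) * laplacian (wired_vertices K) (wired_cond V c K) f z)"
    by (rule W.Green[OF _ _ _ finite_energy_finite[OF fin]]) (use assms in \<open>auto simp: wired_vertices_def\<close>)
  also have "\<dots> = (\<Sum>z\<in>K. (g (Some z) - g None) * laplacian V c (unwire K f) z)"
    by (simp add: sum.reindex laplacian_unwire assms)
  also have "\<dots> = (\<Sum>z\<in>K. (unwire K g z - g None) * laplacian V c (unwire K f) z)"
    by (intro sum.cong) (auto simp: unwire_def)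
  also have "\<dots> = form (unwire K f) (unwire K g)"
    by (rule Green[OF assms _ fin_unwire[OF assms], symmetric]) (simp add: unwire_def)
  finally show ?thesis by simp
qed

lemma wired_path:
  assumes "(x, y) \<in> (edges K c)\<^sup>*"
  shows "(Some x, Some y) \<in> (edges (wired_vertices K) (wired_cond V c K))\<^sup>*"
  using assms
proof (induction rule: rtrancl_induct)
  case (step a b)
  then have "(Some a, Some b) \<in> edges (wired_vertices K) (wired_cond V c K)"
    by (auto simp: nbrs_def wired_vertices_def)
  with step.IH show ?case by (rule rtrancl_into_rtrancl)
qed simp

text \<open>
  The unit potential of the wired network, carried over to \<open>V\<close>. It represents the difference
  only on functions that are constant off \<open>K\<close>, as these come from the wired network.
\<close>

lemma obtain_wired_unit_potential:
  assumes K: "finite K" "K \<subseteq> V" and xy: "x \<in> K" "y \<in> K" "x \<noteq> y" "(x, y) \<in> (edges K c)\<^sup>*"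
  obtains u D k where "u \<in> unit_functions x y" "\<And>a. a \<notin> K \<Longrightarrow> u a = k" "0 < D"
    "\<And>f l. (\<And>a. a \<notin> K \<Longrightarrow> f a = l) \<Longrightarrow> form u f = D * (f x - f y)"
    "finite_resistance (wired_vertices K) (wired_cond V c K) (Some x) (Some y) = inverse D"
proof -
  interpret W: conductances "wired_vertices K" "wired_cond V c K"
    using K by (rule conductances_wired)
  have finW: "finite (wired_vertices K)" using K by (simp add: wired_vertices_def)
  obtain u D where u: "u \<in> unit_functions (Some x) (Some y)" "0 < D"
    and repr: "\<And>f. W.form u f = D * (f (Some x) - f (Some y))"
    by (rule W.obtain_unit_potential[OF finW _ wired_path[OF xy(4)]]) (use xy in auto)
  show ?thesis
  proof (rule that[of "unwire K u" "u None" D])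
    show "unwire K u \<in> unit_functions x y"
      using u xy by (auto simp: unit_functions_def unwire_def)
    show "unwire K u a = u None" if "a \<notin> K" for a using that by (simp add: unwire_def)
    show "0 < D" by fact
    show "form (unwire K u) f = D * (f x - f y)" if f: "\<And>a. a \<notin> K \<Longrightarrow> f a = l" for f l
    proof -
      define g where "g = case_option l f"
      have "f = unwire K g" using f by (auto simp: unwire_def g_def fun_eq_iff)
      then have "form (unwire K u) f = W.form u g" using form_unwire[OF K] by simp
      then show ?thesis by (simp add: repr g_def)
    qed
    show "finite_resistance (wired_vertices K) (wired_cond V c K) (Some x) (Some y) = inverse D"
      by (rule W.finite_resistance_eq[OF finW _ _ _ _ u(2) repr])
         (use xy u(1) in \<open>auto simp: wired_vertices_def unit_functions_def\<close>)
  qed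
qed

end

section \<open>Finite connected subnetworks and exhaustions\<close>

lemma connected_Un:
  assumes "connected_network K c" "connected_network L c" "z \<in> K" "z \<in> L"
  shows "connected_network (K \<union> L) c"
proof -
  have "edges K c \<subseteq> edges (K \<union> L) c" "edges L c \<subseteq> edges (K \<union> L) c"
    by (auto simp: nbrs_def)
  note mono = this[THEN rtrancl_mono]
  have "(a, z) \<in> (edges (K \<union> L) c)\<^sup>*" "(z, a) \<in> (edges (K \<union> L) c)\<^sup>*" if "a \<in> K \<union> L" for a
    using that assms mono unfolding connected_network_def by blast+
  then show ?thesis unfolding connected_network_def by (meson rtrancl_trans)
qed

context resistance_network
begin

sublocale conductances V c
proof
  show "c a summable_on V" if "a \<in> V" for a
  proof -
    have "c a summable_on nbrs V c a \<longleftrightarrow> c a summable_on V"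
      using cond_nonneg[OF that]
      by (intro summable_on_cong_neutral) (auto simp: nbrs_def order.order_iff_strict)
    then show ?thesis using cond_summable[OF that] by simp
  qed
qed (auto intro: cond_nonneg cond_sym)

text \<open>
  A vertex has countably many neighbours since its conductances are summable, and by
  connectedness all vertices are reached from one in finitely many steps. Countability is what
  makes exhaustions exist.
\<close>

lemma countable_vertices: "countable V"
proof (cases "V = {}")
  case False
  then obtain x where x: "x \<in> V" by blast
  have nbrs: "countable (nbrs V c a)" if "a \<in> V" for a
    using summable_countable_real[OF summable[OF that]]
    by (rule countable_subset[rotated]) (auto simp: nbrs_def)
  have "countable (((edges V c) ^^ n) `` {x})" for n
  proof (induction n)
    case (Suc n)
    have "((edges V c) ^^ Suc n) `` {x} \<subseteq> (\<Union>a\<in>((edges V c) ^^ n) `` {x} \<inter> V. nbrs V c a)"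
      by auto
    moreover have "countable (\<Union>a\<in>((edges V c) ^^ n) `` {x} \<inter> V. nbrs V c a)"
      using Suc nbrs by (intro countable_UN) auto
    ultimately show ?case by (rule countable_subset)
  qed simp
  then have "countable (\<Union>n. ((edges V c) ^^ n) `` {x})" by simp
  moreover have "V \<subseteq> (\<Union>n. ((edges V c) ^^ n) `` {x})"
    using connected x unfolding connected_network_def
    by (force simp: rtrancl_is_UN_relpow)
  ultimately show ?thesis by (rule countable_subset[rotated])
qed simp

lemma ex_finite_connected_superset:
  assumes "finite S" "S \<subseteq> V" "x \<in> V"
  shows "\<exists>K. finite K \<and> K \<subseteq> V \<and> connected_network K c \<and> x \<in> K \<and> S \<subseteq> K"
  using assms(1,2)
proof (induction S)
  case empty
  show ?case
    using assms(3) by (intro exI[of _ "{x}"]) (simp add: connected_network_def)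
next
  case (insert s S)
  then obtain K where K: "finite K" "K \<subseteq> V" "connected_network K c" "x \<in> K" "S \<subseteq> K" by auto
  have "(x, s) \<in> (edges V c)\<^sup>*"
    using connected insert.prems assms(3) by (auto simp: connected_network_def)
  then have "\<exists>L. finite L \<and> L \<subseteq> V \<and> connected_network L c \<and> x \<in> L \<and> s \<in> L"
  proof (induction rule: rtrancl_induct)
    case base
    show ?case
      using assms(3) by (intro exI[of _ "{x}"]) (simp add: connected_network_def)
  next
    case (step a b)
    then obtain L where L: "finite L" "L \<subseteq> V" "connected_network L c" "x \<in> L" "a \<in> L" by blast
    have ab: "a \<in> V" "b \<in> V" "0 < c a b" "0 < c b a"
      using step.hyps(2) sym by (auto simp: nbrs_def)
    then have "(a, b) \<in> edges {a, b} c" "(b, a) \<in> edges {a, b} c"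
      by (auto simp: nbrs_def)
    then have "connected_network {a, b} c"
      unfolding connected_network_def by blast
    with L(3) have "connected_network (L \<union> {a, b}) c"
      by (rule connected_Un[where z=a]) (use L in auto)
    then show ?case using L ab by (intro exI[of _ "L \<union> {a, b}"]) auto
  qed
  then obtain L where L: "finite L" "L \<subseteq> V" "connected_network L c" "x \<in> L" "s \<in> L" by blast
  then have "connected_network (K \<union> L) c" using K by (blast intro: connected_Un)
  then show ?case using K L by (intro exI[of _ "K \<union> L"]) auto
qed

text \<open>
  The class of \<open>h\<close> modulo constants lies in \<open>Harm\<close>, because the Laplacian is the same on all
  members of the class.
\<close>

lemma harmonic_imp_constant:
  assumes "Harm V c = {energy_zero V}" "fin h" "\<And>z. z \<in> V \<Longrightarrow> laplacian V c h z = 0"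
    and x: "x \<in> V" and y: "y \<in> V"
  shows "h x = h y"
proof -
  let ?C = "mod_const V `` {h}"
  have "?C \<in> energy_space V c"
    unfolding energy_space_def using energy_finite[OF assms(2)] by (intro quotientI) simp
  moreover have "laplacian V c v z = 0" if v: "v \<in> ?C" and z: "z \<in> V" for v z
  proof -
    obtain k where "\<And>a. a \<in> V \<Longrightarrow> h a = v a + k" using v by (auto simp: mod_const_def)
    then have "laplacian V c v z = laplacian V c h z"
      unfolding laplacian_eq_infsum[OF z] using z by (intro infsum_cong) simp
    then show ?thesis using assms(3)[OF z] by simp
  qed
  ultimately have "?C \<in> Harm V c" by (simp add: Harm_def)
  then have "?C = energy_zero V" using assms(1) by simp
  moreover have "h \<in> ?C" by (auto simp: mod_const_def)
  ultimately have "h \<in> energy_zero V" by simp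
  then obtain k where "\<And>a. a \<in> V \<Longrightarrow> 0 = h a + k" by (auto simp: energy_zero_def mod_const_def)
  from this[OF x] this[OF y] show ?thesis by simp
qed

end

locale vertex_pair = resistance_network +
  fixes x y
  assumes x: "x \<in> V" and y: "y \<in> V" and neq: "x \<noteq> y"
begin

definition subnetworks :: "'a set set" where
  "subnetworks = {K. finite K \<and> K \<subseteq> V \<and> connected_network K c \<and> x \<in> K \<and> y \<in> K}"

lemma subnetworksD:
  assumes "K \<in> subnetworks"
  shows "finite K" "K \<subseteq> V" "x \<in> K" "y \<in> K" "(x, y) \<in> (edges K c)\<^sup>*" "conductances K c"
  using assms conductances_subset by (auto simp: subnetworks_def connected_network_def)

lemma obtain_subnetwork:
  assumes "finite S" "S \<subseteq> V"
  obtains K where "K \<in> subnetworks" "S \<subseteq> K"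
  using ex_finite_connected_superset[of "insert y S" x] assms x y that
  by (auto simp: subnetworks_def)

lemma subnetworks_nonempty: "subnetworks \<noteq> {}"
  using obtain_subnetwork[of "{}"] by blast

text \<open>
  Without an exhaustion the defining property of the free and wired resistances would hold for
  every number; its existence makes their values unique. Vertices of an enumeration are added one
  by one, each time passing to a finite connected superset.
\<close>

lemma obtain_exhaustion:
  obtains K where "exhaustion V c K" "\<And>k. K k \<in> subnetworks"
proof -
  define e where "e = from_nat_into V"
  have e: "range e = V"
    unfolding e_def using x countable_vertices by (intro range_from_nat_into) auto
  have "\<exists>K. \<forall>n. K n \<in> subnetworks \<and> (K n \<subseteq> K (Suc n) \<and> e n \<in> K (Suc n))"
  proof (rule dependent_nat_choice)
    show "\<exists>K. K \<in> subnetworks" using subnetworks_nonempty by blast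
    fix K n assume K: "K \<in> subnetworks"
    have "insert (e n) K \<subseteq> V" using e K by (auto simp: subnetworks_def)
    then obtain L where "L \<in> subnetworks" "insert (e n) K \<subseteq> L"
      using obtain_subnetwork[of "insert (e n) K"] subnetworksD(1)[OF K] by blast
    then show "\<exists>L. L \<in> subnetworks \<and> (K \<subseteq> L \<and> e n \<in> L)" by blast
  qed
  then obtain K where K: "\<And>n. K n \<in> subnetworks" "\<And>n. K n \<subseteq> K (Suc n)" "\<And>n. e n \<in> K (Suc n)"
    by blast
  have "(\<Union>k. K k) = V"
  proof
    show "(\<Union>k. K k) \<subseteq> V" using K(1) by (auto simp: subnetworks_def)
    show "V \<subseteq> (\<Union>k. K k)" using K(3) e by blast
  qed
  moreover have "incseq K" using K(2) by (rule incseq_SucI)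
  ultimately have "exhaustion V c K"
    unfolding exhaustion_def using K(1) by (auto simp: subnetworks_def)
  then show ?thesis using that K(1) by blast
qed

lemma exhaustion_eventually_superset:
  assumes "exhaustion V c K" "finite S" "S \<subseteq> V"
  shows "eventually (\<lambda>k. S \<subseteq> K k) sequentially"
  using assms(2,3)
proof (induction S)
  case (insert s S)
  then obtain k where k: "s \<in> K k" using assms(1) by (auto simp: exhaustion_def)
  have "eventually (\<lambda>n. s \<in> K n) sequentially"
    using assms(1) k unfolding exhaustion_def incseq_def eventually_sequentially by blast
  then show ?case using insert by (auto elim: eventually_elim2)
qed simp

lemma exhaustion_subnetworks:
  assumes "exhaustion V c K" "\<forall>k. x \<in> K k \<and> y \<in> K k"
  shows "K k \<in> subnetworks"
  using assms by (auto simp: exhaustion_def subnetworks_def)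

text \<open>
  Every finite connected subnetwork is eventually contained in the members of an exhaustion, so a
  monotone quantity has the same limit along all of them.
\<close>

lemma tendsto_Sup_subnetworks:
  fixes g :: "'a set \<Rightarrow> real"
  assumes mono: "\<And>K L. K \<in> subnetworks \<Longrightarrow> L \<in> subnetworks \<Longrightarrow> K \<subseteq> L \<Longrightarrow> g K \<le> g L"
    and bdd: "bdd_above (g ` subnetworks)"
    and K: "exhaustion V c K" "\<And>k. K k \<in> subnetworks"
  shows "(\<lambda>k. g (K k)) \<longlonglongrightarrow> Sup (g ` subnetworks)"
proof (rule increasing_tendsto)
  show "eventually (\<lambda>k. g (K k) \<le> Sup (g ` subnetworks)) sequentially"
    using K(2) bdd by (intro always_eventually allI cSup_upper) auto
  fix r assume "r < Sup (g ` subnetworks)"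
  then obtain L where L: "L \<in> subnetworks" "r < g L"
    using less_cSup_iff[OF _ bdd] subnetworks_nonempty by auto
  have "eventually (\<lambda>k. L \<subseteq> K k) sequentially"
    using K(1) subnetworksD(1,2)[OF L(1)] by (rule exhaustion_eventually_superset)
  then show "eventually (\<lambda>k. r < g (K k)) sequentially"
    by eventually_elim (use L mono K(2) in \<open>force intro: less_le_trans\<close>)
qed

lemma tendsto_Inf_subnetworks:
  fixes g :: "'a set \<Rightarrow> real"
  assumes anti: "\<And>K L. K \<in> subnetworks \<Longrightarrow> L \<in> subnetworks \<Longrightarrow> K \<subseteq> L \<Longrightarrow> g L \<le> g K"
    and bdd: "bdd_below (g ` subnetworks)"
    and K: "exhaustion V c K" "\<And>k. K k \<in> subnetworks"
  shows "(\<lambda>k. g (K k)) \<longlonglongrightarrow> Inf (g ` subnetworks)"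
proof -
  have "(\<lambda>k. - g (K k)) \<longlonglongrightarrow> Sup ((\<lambda>K. - g K) ` subnetworks)"
  proof (rule tendsto_Sup_subnetworks[OF _ _ K])
    show "bdd_above ((\<lambda>K. - g K) ` subnetworks)"
    proof -
      obtain m where "\<And>K. K \<in> subnetworks \<Longrightarrow> m \<le> g K"
        using bdd by (auto simp: bdd_below_def)
      then show ?thesis by (auto intro: bdd_aboveI2[where M="- m"])
    qed
  qed (simp add: anti)
  then have "(\<lambda>k. - g (K k)) \<longlonglongrightarrow> - Inf (g ` subnetworks)"
    by (simp add: Inf_real_def image_image)
  then show ?thesis by (rule tendsto_minus_cancel)
qed

section \<open>Monotonicity and the two limits\<close>

definition free_conductance :: "'a set \<Rightarrow> real" where
  "free_conductance K = inverse (finite_resistance K c x y)"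

definition wired_conductance :: "'a set \<Rightarrow> real" where
  "wired_conductance K =
     inverse (finite_resistance (wired_vertices K) (wired_cond V c K) (Some x) (Some y))"

lemma obtain_free_potential:
  assumes "K \<in> subnetworks"
  obtains u where "u \<in> unit_functions x y" "0 < free_conductance K"
    "\<And>f. energy_form K c u f = free_conductance K * (f x - f y)"
proof -
  interpret K: conductances K c using assms by (rule subnetworksD)
  note K = subnetworksD[OF assms]
  obtain u C where u: "u \<in> unit_functions x y" "0 < C" "\<And>f. K.form u f = C * (f x - f y)"
    by (rule K.obtain_unit_potential[OF K(1) neq K(5)]) blast
  have "finite_resistance K c x y = inverse C"
    by (rule K.finite_resistance_eq[OF K(1,3,4) _ _ u(2,3)]) (use u(1) in \<open>auto simp: unit_functions_def\<close>)
  then have C: "C = free_conductance K" by (simp add: free_conductance_def)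
  show ?thesis by (rule that[OF u[unfolded C]])
qed

lemma obtain_wired_potential:
  assumes "K \<in> subnetworks"
  obtains u k where "u \<in> unit_functions x y" "\<And>a. a \<notin> K \<Longrightarrow> u a = k" "0 < wired_conductance K"
    "\<And>f l. (\<And>a. a \<notin> K \<Longrightarrow> f a = l) \<Longrightarrow> form u f = wired_conductance K * (f x - f y)"
proof -
  note K = subnetworksD[OF assms]
  obtain u D k where u: "u \<in> unit_functions x y" "\<And>a. a \<notin> K \<Longrightarrow> u a = k" "0 < D"
    "\<And>f l. (\<And>a. a \<notin> K \<Longrightarrow> f a = l) \<Longrightarrow> form u f = D * (f x - f y)"
    and r: "finite_resistance (wired_vertices K) (wired_cond V c K) (Some x) (Some y) = inverse D"
    by (rule obtain_wired_unit_potential[OF K(1-4) neq K(5)]) blast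
  have D: "D = wired_conductance K" using r by (simp add: wired_conductance_def)
  show ?thesis by (rule that[OF u[unfolded D]])
qed

lemma unit_functions_diff: "u \<in> unit_functions x y \<Longrightarrow> u x - u y = 1"
  by (simp add: unit_functions_def)

text \<open>
  Restricting a function to \<open>K\<close> can only lower its energy.
\<close>

lemma free_conductance_le_energy:
  assumes "K \<in> subnetworks" "fin f"
  shows "free_conductance K * (f x - f y)\<^sup>2 \<le> form f f"
proof -
  interpret K: conductances K c using assms(1) by (rule subnetworksD)
  note K = subnetworksD[OF assms(1)]
  obtain u where u: "u \<in> unit_functions x y" "0 < free_conductance K"
    "\<And>f. K.form u f = free_conductance K * (f x - f y)"
    by (rule obtain_free_potential[OF assms(1)]) blast
  have "free_conductance K * (f x - f y)\<^sup>2 \<le> K.form f f"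
    by (rule K.represents_imp_bound[OF finite_energy_finite[OF K(1)] finite_energy_finite[OF K(1)] _ u(3)])
       (simp add: u(3) unit_functions_diff[OF u(1)])
  also have "\<dots> \<le> form f f" using K(2) assms(2) by (intro energy_form_subset_mono) auto
  finally show ?thesis .
qed

text \<open>
  Rayleigh monotonicity: the unit potential on \<open>L\<close> competes on \<open>K\<close>, where its energy is no larger.
\<close>

lemma free_conductance_mono:
  assumes "K \<in> subnetworks" "L \<in> subnetworks" "K \<subseteq> L"
  shows "free_conductance K \<le> free_conductance L"
proof -
  interpret K: conductances K c using assms(1) by (rule subnetworksD)
  note K = subnetworksD[OF assms(1)] and L = subnetworksD[OF assms(2)]
  obtain u where u: "u \<in> unit_functions x y" "0 < free_conductance K"
    "\<And>f. K.form u f = free_conductance K * (f x - f y)"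
    by (rule obtain_free_potential[OF assms(1)]) blast
  obtain v where v: "v \<in> unit_functions x y" "0 < free_conductance L"
    "\<And>f. energy_form L c v f = free_conductance L * (f x - f y)"
    by (rule obtain_free_potential[OF assms(2)]) blast
  have "free_conductance K * (v x - v y)\<^sup>2 \<le> K.form v v"
    by (rule K.represents_imp_bound[OF finite_energy_finite[OF K(1)] finite_energy_finite[OF K(1)] _ u(3)])
       (simp add: u(3) unit_functions_diff[OF u(1)])
  also have "\<dots> \<le> energy_form L c v v"
    using assms(3) L(1,2) by (intro energy_form_subset_mono finite_energy_finite)
  finally show ?thesis by (simp add: v(3) unit_functions_diff[OF v(1)])
qed

lemma fin_const_off_subnetwork:
  assumes "K \<in> subnetworks" "\<And>a. a \<notin> K \<Longrightarrow> u a = k"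
  shows "fin u"
  using subnetworksD(1,2)[OF assms(1)] assms(2) by (intro fin_const_off) auto

text \<open>
  The wired unit potential of \<open>K\<close> is constant off the larger set \<open>L\<close> and so competes there.
\<close>

lemma wired_conductance_antimono:
  assumes "K \<in> subnetworks" "L \<in> subnetworks" "K \<subseteq> L"
  shows "wired_conductance L \<le> wired_conductance K"
proof -
  obtain u k where u: "u \<in> unit_functions x y" "\<And>a. a \<notin> K \<Longrightarrow> u a = k"
    "0 < wired_conductance K"
    "\<And>f m. (\<And>a. a \<notin> K \<Longrightarrow> f a = m) \<Longrightarrow> form u f = wired_conductance K * (f x - f y)"
    by (rule obtain_wired_potential[OF assms(1)]) blast
  obtain v l where v: "v \<in> unit_functions x y" "\<And>a. a \<notin> L \<Longrightarrow> v a = l"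
    "0 < wired_conductance L"
    "\<And>f m. (\<And>a. a \<notin> L \<Longrightarrow> f a = m) \<Longrightarrow> form v f = wired_conductance L * (f x - f y)"
    by (rule obtain_wired_potential[OF assms(2)]) blast
  have "wired_conductance L * (u x - u y)\<^sup>2 \<le> form u u"
  proof (rule represents_imp_bound)
    show "fin v" using assms(2) v(2) by (rule fin_const_off_subnetwork)
    show "fin u" using assms(1) u(2) by (rule fin_const_off_subnetwork)
    have "form v v = wired_conductance L * (v x - v y)" using v(2) by (rule v(4))
    then show "form v v = wired_conductance L" by (simp add: unit_functions_diff[OF v(1)])
    show "form v u = wired_conductance L * (u x - u y)" by (rule v(4)[of u k]) (use u(2) assms(3) in auto)
  qed
  also have "form u u = wired_conductance K * (u x - u y)" using u(2) by (rule u(4))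
  finally show ?thesis by (simp add: unit_functions_diff[OF u(1)])
qed

text \<open>
  The wired unit potential of \<open>L\<close> is a function on \<open>V\<close>, so its energy bounds the free
  conductance of every \<open>K\<close>. Hence both limits are finite and positive.
\<close>

lemma free_conductance_le_wired_conductance:
  assumes "K \<in> subnetworks" "L \<in> subnetworks"
  shows "free_conductance K \<le> wired_conductance L"
proof -
  obtain u k where u: "u \<in> unit_functions x y" "\<And>a. a \<notin> L \<Longrightarrow> u a = k"
    "0 < wired_conductance L"
    "\<And>f m. (\<And>a. a \<notin> L \<Longrightarrow> f a = m) \<Longrightarrow> form u f = wired_conductance L * (f x - f y)"
    by (rule obtain_wired_potential[OF assms(2)]) blast
  have "fin u" using assms(2) u(2) by (rule fin_const_off_subnetwork)
  then have "free_conductance K * (u x - u y)\<^sup>2 \<le> form u u"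
    by (rule free_conductance_le_energy[OF assms(1)])
  also have "form u u = wired_conductance L * (u x - u y)" using u(2) by (rule u(4))
  finally show ?thesis by (simp add: unit_functions_diff[OF u(1)])
qed

definition free_limit :: real where
  "free_limit = Sup (free_conductance ` subnetworks)"

definition wired_limit :: real where
  "wired_limit = Inf (wired_conductance ` subnetworks)"

lemma bdd_above_free: "bdd_above (free_conductance ` subnetworks)"
proof -
  obtain L where "L \<in> subnetworks" using subnetworks_nonempty by blast
  then show ?thesis by (intro bdd_aboveI2[where M="wired_conductance L"] free_conductance_le_wired_conductance)
qed

lemma bdd_below_wired: "bdd_below (wired_conductance ` subnetworks)"
proof -
  obtain K where "K \<in> subnetworks" using subnetworks_nonempty by blast
  then show ?thesis by (intro bdd_belowI2[where m="free_conductance K"] free_conductance_le_wired_conductance)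
qed

lemma free_limit_upper: "K \<in> subnetworks \<Longrightarrow> free_conductance K \<le> free_limit"
  unfolding free_limit_def using bdd_above_free by (intro cSup_upper) auto

lemma wired_limit_lower: "K \<in> subnetworks \<Longrightarrow> wired_limit \<le> wired_conductance K"
  unfolding wired_limit_def using bdd_below_wired by (intro cInf_lower) auto

lemma free_limit_pos: "0 < free_limit"
proof -
  obtain K where K: "K \<in> subnetworks" using subnetworks_nonempty by blast
  then have "0 < free_conductance K" by (rule obtain_free_potential)
  then show ?thesis using free_limit_upper[OF K] by simp
qed

lemma wired_limit_pos: "0 < wired_limit"
proof -
  obtain K where K: "K \<in> subnetworks" using subnetworks_nonempty by blast
  then have "0 < free_conductance K" by (rule obtain_free_potential)
  also have "free_conductance K \<le> wired_limit"
    unfolding wired_limit_def using subnetworks_nonempty free_conductance_le_wired_conductance[OF K]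
    by (intro cInf_greatest) auto
  finally show ?thesis .
qed

lemma common_limit_eq:
  assumes "\<And>K. exhaustion V c K \<Longrightarrow> (\<And>k. K k \<in> subnetworks) \<Longrightarrow> (\<lambda>k. g (K k)) \<longlonglongrightarrow> (l::real)"
  shows "(THE r. \<forall>K. exhaustion V c K \<and> (\<forall>k. x \<in> K k \<and> y \<in> K k) \<longrightarrow> (\<lambda>k. g (K k)) \<longlonglongrightarrow> r) = l"
proof (rule the_equality)
  show "\<forall>K. exhaustion V c K \<and> (\<forall>k. x \<in> K k \<and> y \<in> K k) \<longrightarrow> (\<lambda>k. g (K k)) \<longlonglongrightarrow> l"
    using assms exhaustion_subnetworks by blast
  fix r assume r: "\<forall>K. exhaustion V c K \<and> (\<forall>k. x \<in> K k \<and> y \<in> K k) \<longrightarrow> (\<lambda>k. g (K k)) \<longlonglongrightarrow> r"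
  obtain K where K: "exhaustion V c K" "\<And>k. K k \<in> subnetworks" by (rule obtain_exhaustion) blast
  then have "(\<lambda>k. g (K k)) \<longlonglongrightarrow> r" using r subnetworksD(3,4) by blast
  then show "r = l" using assms[OF K] by (rule LIMSEQ_unique)
qed

lemma free_resistance_eq: "free_resistance V c x y = inverse free_limit"
  unfolding free_resistance_def
proof (rule common_limit_eq)
  fix K assume K: "exhaustion V c K" "\<And>k. K k \<in> subnetworks"
  have "(\<lambda>k. free_conductance (K k)) \<longlonglongrightarrow> free_limit"
    unfolding free_limit_def using free_conductance_mono bdd_above_free K by (rule tendsto_Sup_subnetworks)
  then have "(\<lambda>k. inverse (free_conductance (K k))) \<longlonglongrightarrow> inverse free_limit"
    using free_limit_pos by (intro tendsto_inverse) auto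
  then show "(\<lambda>k. finite_resistance (K k) c x y) \<longlonglongrightarrow> inverse free_limit"
    by (simp add: free_conductance_def)
qed

lemma wired_conductance_tendsto:
  assumes "exhaustion V c K" "\<And>k. K k \<in> subnetworks"
  shows "(\<lambda>k. wired_conductance (K k)) \<longlonglongrightarrow> wired_limit"
  unfolding wired_limit_def using wired_conductance_antimono bdd_below_wired assms
  by (rule tendsto_Inf_subnetworks)

lemma wired_resistance_eq: "wired_resistance V c x y = inverse wired_limit"
  unfolding wired_resistance_def
proof (rule common_limit_eq)
  fix K assume K: "exhaustion V c K" "\<And>k. K k \<in> subnetworks"
  have "(\<lambda>k. inverse (wired_conductance (K k))) \<longlonglongrightarrow> inverse wired_limit"
    using wired_limit_pos wired_conductance_tendsto[OF K] by (intro tendsto_inverse) auto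
  then show "(\<lambda>k. finite_resistance (wired_vertices (K k)) (wired_cond V c (K k)) (Some x) (Some y))
      \<longlonglongrightarrow> inverse wired_limit"
    by (simp add: wired_conductance_def)
qed

end

section \<open>Unit potentials on the infinite network\<close>

context vertex_pair
begin

lemma free_limit_le_energy:
  assumes "fin f"
  shows "free_limit * (f x - f y)\<^sup>2 \<le> form f f"
proof (cases "f x = f y")
  case False
  have "free_limit \<le> form f f / (f x - f y)\<^sup>2"
    unfolding free_limit_def
    by (rule cSup_least)
       (use subnetworks_nonempty free_conductance_le_energy[OF _ assms] False in \<open>auto simp: field_simps\<close>)
  then show ?thesis using False by (simp add: field_simps)
qed (simp add: form_self_nonneg)

text \<open>
  The unit potentials of finite subnetworks \<open>K \<supseteq> S\<close> have energy at most \<open>free_limit\<close> on \<open>S\<close>. By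
  compactness one unit function has this property for all finite \<open>S\<close>, hence energy at most
  \<open>free_limit\<close> on \<open>V\<close>, which is the least possible.
\<close>

lemma obtain_free_limit_potential:
  obtains u where "u \<in> unit_functions x y" "fin u"
    "\<And>f. fin f \<Longrightarrow> form u f = free_limit * (f x - f y)"
proof -
  obtain u where u: "u \<in> unit_functions x y"
    and "\<And>S. finite S \<Longrightarrow> S \<subseteq> V \<Longrightarrow> u \<in> {u. energy_form S c u u \<le> free_limit}"
  proof (rule compactness_over_finite_sets[where A="\<lambda>S. {u. energy_form S c u u \<le> free_limit}" and V=V])
    fix S assume S: "finite S" "S \<subseteq> V"
    then show "closed {u. energy_form S c u u \<le> free_limit}"
      using closed_energy_le[of S "\<lambda>_. 0" free_limit] by simp
    obtain K where K: "K \<in> subnetworks" "S \<subseteq> K" using S by (rule obtain_subnetwork)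
    obtain v where v: "v \<in> unit_functions x y" "0 < free_conductance K"
      "\<And>f. energy_form K c v f = free_conductance K * (f x - f y)"
      by (rule obtain_free_potential[OF K(1)]) blast
    have "energy_form S c v v \<le> energy_form K c v v"
      using K subnetworksD(1,2) by (intro energy_form_subset_mono finite_energy_finite) auto
    also have "\<dots> = free_conductance K" by (simp add: v(3) unit_functions_diff[OF v(1)])
    also have "\<dots> \<le> free_limit" using K(1) by (rule free_limit_upper)
    finally show "unit_functions x y \<inter> {u. energy_form S c u u \<le> free_limit} \<noteq> {}"
      using v(1) by blast
  next
    fix S T assume T: "finite T" "T \<subseteq> V" "S \<subseteq> T"
    show "{u. energy_form T c u u \<le> free_limit} \<subseteq> {u. energy_form S c u u \<le> free_limit}"
      using energy_form_subset_mono[OF T(3,2) finite_energy_finite[OF T(1)]]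
      by (auto intro: order_trans)
  qed blast
  then have e: "fin u" "form u u \<le> free_limit" using finite_energyI[of u free_limit] by auto
  have "form u f = free_limit * (f x - f y)" if "fin f" for f
    using e(1) unit_functions_diff[OF u] e(2) that free_limit_le_energy by (rule extremal_imp_represents)
  then show ?thesis using that u e(1) by blast
qed

text \<open>
  Extremality is not available here, since the limit of functions that are constant off finite sets
  need not be of this kind. Instead the limit is taken in energy: the wired unit potentials \<open>U L\<close> form
  a Cauchy net, and compactness provides a unit function \<open>w\<close> whose energy distance to each \<open>U L\<close> is
  at most the square root of \<open>wired_conductance L - wired_limit\<close>. Testing with \<open>\<delta>\<^sub>z\<close> and using
  Cauchy--Schwarz transfers the Laplacian to \<open>w\<close>.
\<close>

lemma obtain_wired_limit_potential:
  obtains w where "w \<in> unit_functions x y" "fin w"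
    "\<And>z. z \<in> V \<Longrightarrow> laplacian V c w z = wired_limit * (indicator {z} x - indicator {z} y)"
proof -
  have "\<forall>K\<in>subnetworks. \<exists>u. u \<in> unit_functions x y \<and> fin u \<and>
    form u u = wired_conductance K \<and> (\<exists>k. \<forall>a. a \<notin> K \<longrightarrow> u a = k) \<and>
    (\<forall>f l. (\<forall>a. a \<notin> K \<longrightarrow> f a = l) \<longrightarrow> form u f = wired_conductance K * (f x - f y))"
  proof
    fix K assume K: "K \<in> subnetworks"
    obtain u k where u: "u \<in> unit_functions x y" "\<And>a. a \<notin> K \<Longrightarrow> u a = k"
      "0 < wired_conductance K"
      "\<And>f m. (\<And>a. a \<notin> K \<Longrightarrow> f a = m) \<Longrightarrow> form u f = wired_conductance K * (f x - f y)"
      by (rule obtain_wired_potential[OF K]) blast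
    have "form u u = wired_conductance K * (u x - u y)" using u(2) by (rule u(4))
    then have "form u u = wired_conductance K" by (simp add: unit_functions_diff[OF u(1)])
    moreover have "fin u" using K u(2) by (rule fin_const_off_subnetwork)
    moreover have "\<forall>f l. (\<forall>a. a \<notin> K \<longrightarrow> f a = l) \<longrightarrow> form u f = wired_conductance K * (f x - f y)"
    proof (intro allI impI)
      fix f :: "'a \<Rightarrow> real" and l assume "\<forall>a. a \<notin> K \<longrightarrow> f a = l"
      then show "form u f = wired_conductance K * (f x - f y)" by (intro u(4)[of f l]) blast
    qed
    ultimately show "\<exists>u. u \<in> unit_functions x y \<and> fin u \<and>
      form u u = wired_conductance K \<and> (\<exists>k. \<forall>a. a \<notin> K \<longrightarrow> u a = k) \<and>
      (\<forall>f l. (\<forall>a. a \<notin> K \<longrightarrow> f a = l) \<longrightarrow> form u f = wired_conductance K * (f x - f y))"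
      using u(1,2) by (intro exI[of _ u]) blast
  qed
  then obtain U where U: "\<forall>K\<in>subnetworks. U K \<in> unit_functions x y \<and> fin (U K) \<and>
    form (U K) (U K) = wired_conductance K \<and> (\<exists>k. \<forall>a. a \<notin> K \<longrightarrow> U K a = k) \<and>
    (\<forall>f l. (\<forall>a. a \<notin> K \<longrightarrow> f a = l) \<longrightarrow> form (U K) f = wired_conductance K * (f x - f y))"
    by (rule bchoice[THEN exE])
  have unit: "U K \<in> unit_functions x y" and finU: "fin (U K)"
    and energyU: "form (U K) (U K) = wired_conductance K"
    and repr: "(\<forall>a. a \<notin> K \<longrightarrow> f a = l) \<Longrightarrow> form (U K) f = wired_conductance K * (f x - f y)"
    if "K \<in> subnetworks" for K f l
    using U that by blast+
  \<comment> \<open>Since \<open>U L\<close> is constant off \<open>M\<close>, the mixed term is \<open>form (U M) (U L) = form (U M) (U M)\<close>.\<close>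
  have dist: "form (\<lambda>a. U M a - U L a) (\<lambda>a. U M a - U L a) = wired_conductance L - wired_conductance M"
    if M: "M \<in> subnetworks" and L: "L \<in> subnetworks" and "L \<subseteq> M" for L M
  proof -
    obtain k where "\<forall>a. a \<notin> L \<longrightarrow> U L a = k" using U L by blast
    then have "\<forall>a. a \<notin> M \<longrightarrow> U L a = k" using \<open>L \<subseteq> M\<close> by blast
    then have "form (U M) (U L) = wired_conductance M"
      using repr[OF M] unit_functions_diff[OF unit[OF L]] by fastforce
    then show ?thesis
      by (simp add: form_diff_self finU energyU M L)
  qed
  \<comment> \<open>All \<open>L \<subseteq> S\<close> are put into one condition, so that \<open>A\<close> is antitone in \<open>S\<close>; a set \<open>S\<close> that contains no
      subnetwork gives no condition.\<close>
  define A where "A = (\<lambda>S. \<Inter>L\<in>{L\<in>subnetworks. L \<subseteq> S}.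
    {u. energy_form S c (\<lambda>a. u a - U L a) (\<lambda>a. u a - U L a) \<le> wired_conductance L - wired_limit})"
  obtain w where w: "w \<in> unit_functions x y" and wA: "\<And>S. finite S \<Longrightarrow> S \<subseteq> V \<Longrightarrow> w \<in> A S"
  proof (rule compactness_over_finite_sets[where A=A and V=V])
    fix S assume S: "finite S" "S \<subseteq> V"
    then show "closed (A S)"
      unfolding A_def by (intro closed_INT ballI closed_energy_le)
    obtain M where M: "M \<in> subnetworks" "S \<subseteq> M" using S by (rule obtain_subnetwork)
    have "energy_form S c (\<lambda>a. U M a - U L a) (\<lambda>a. U M a - U L a) \<le> wired_conductance L - wired_limit"
      if L: "L \<in> subnetworks" "L \<subseteq> S" for L
    proof -
      have "energy_form S c (\<lambda>a. U M a - U L a) (\<lambda>a. U M a - U L a)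
          \<le> form (\<lambda>a. U M a - U L a) (\<lambda>a. U M a - U L a)"
        using S(2) M L by (intro energy_form_subset_mono fin_diff finU) auto
      also have "\<dots> = wired_conductance L - wired_conductance M"
        using M L by (intro dist) auto
      also have "\<dots> \<le> wired_conductance L - wired_limit" using wired_limit_lower[OF M(1)] by simp
      finally show ?thesis .
    qed
    then show "unit_functions x y \<inter> A S \<noteq> {}" using unit[OF M(1)] by (auto simp: A_def)
  next
    fix S T assume T: "finite T" "T \<subseteq> V" "S \<subseteq> T"
    have "energy_form S c (\<lambda>a. u a - U L a) (\<lambda>a. u a - U L a)
        \<le> energy_form T c (\<lambda>a. u a - U L a) (\<lambda>a. u a - U L a)" for u L
      by (rule energy_form_subset_mono[OF T(3,2) finite_energy_finite[OF T(1)]])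
    then show "A T \<subseteq> A S" unfolding A_def using T(3) by (fastforce intro: order_trans)
  qed blast
  have close: "fin (\<lambda>a. w a - U L a)"
    "form (\<lambda>a. w a - U L a) (\<lambda>a. w a - U L a) \<le> wired_conductance L - wired_limit"
    if L: "L \<in> subnetworks" for L
  proof -
    have "energy_form S c (\<lambda>a. w a - U L a) (\<lambda>a. w a - U L a) \<le> wired_conductance L - wired_limit"
      if S: "finite S" "S \<subseteq> V" for S
    proof -
      \<comment> \<open>The condition for \<open>L\<close> is part of \<open>A S\<close> only if \<open>L \<subseteq> S\<close>, so \<open>S\<close> is enlarged by \<open>L\<close>.\<close>
      have SL: "finite (S \<union> L)" "S \<union> L \<subseteq> V" using S subnetworksD(1,2)[OF L] by auto
      have "energy_form S c (\<lambda>a. w a - U L a) (\<lambda>a. w a - U L a)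
          \<le> energy_form (S \<union> L) c (\<lambda>a. w a - U L a) (\<lambda>a. w a - U L a)"
        by (rule energy_form_subset_mono[OF _ SL(2) finite_energy_finite[OF SL(1)]]) simp
      also have "\<dots> \<le> wired_conductance L - wired_limit"
        using wA[OF SL] L by (auto simp: A_def)
      finally show ?thesis .
    qed
    note finite_energyI[OF this]
    then show "fin (\<lambda>a. w a - U L a)"
      "form (\<lambda>a. w a - U L a) (\<lambda>a. w a - U L a) \<le> wired_conductance L - wired_limit" by auto
  qed
  obtain K where K: "exhaustion V c K" "\<And>k. K k \<in> subnetworks" by (rule obtain_exhaustion) blast
  have finw: "fin w"
    using fin_add[OF close(1)[OF K(2)[of 0]] finU[OF K(2)[of 0]]] by simp
  have "laplacian V c w z = wired_limit * (indicator {z} x - indicator {z} y)" if z: "z \<in> V" for z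
  proof -
    let ?d = "indicator {z} x - indicator {z} y :: real"
    let ?E = "form (indicator {z}) (indicator {z})"
    let ?r = "\<lambda>k. form (\<lambda>a. w a - U (K k) a) (indicator {z})"
    have fz: "fin (indicator {z})" using z by (rule fin_indicator)
    have lim: "(\<lambda>k. wired_conductance (K k)) \<longlonglongrightarrow> wired_limit"
      using K by (rule wired_conductance_tendsto)
    have "(\<lambda>k. (wired_conductance (K k) - wired_limit) * ?E) \<longlonglongrightarrow> (wired_limit - wired_limit) * ?E"
      by (intro tendsto_intros lim)
    then have bound_lim: "(\<lambda>k. (wired_conductance (K k) - wired_limit) * ?E) \<longlonglongrightarrow> 0"
      by (simp only: diff_self mult_zero_left)
    have bound: "(?r k)\<^sup>2 \<le> (wired_conductance (K k) - wired_limit) * ?E" for k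
      using form_Cauchy_Schwarz[OF close(1)[OF K(2)] fz]
        mult_right_mono[OF close(2)[OF K(2)] form_self_nonneg]
      by (rule order_trans)
    have "(\<lambda>k. (?r k)\<^sup>2) \<longlonglongrightarrow> 0"
      by (rule real_tendsto_sandwich[OF always_eventually[OF allI[OF zero_le_power2]]
            always_eventually[OF allI[OF bound]] tendsto_const bound_lim])
    then have "(\<lambda>k. sqrt ((?r k)\<^sup>2)) \<longlonglongrightarrow> sqrt 0" by (rule tendsto_real_sqrt)
    then have r: "?r \<longlonglongrightarrow> 0" by (simp add: tendsto_rabs_zero_iff)
    \<comment> \<open>Once \<open>z\<close> lies in \<open>K k\<close>, its indicator is constant off \<open>K k\<close> and \<open>U (K k)\<close> can be tested with it.\<close>
    have "eventually (\<lambda>k. {z} \<subseteq> K k) sequentially"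
      using K(1) by (rule exhaustion_eventually_superset) (use z in auto)
    then have "eventually (\<lambda>k. form w (indicator {z}) = ?r k + wired_conductance (K k) * ?d) sequentially"
    proof eventually_elim
      case (elim k)
      have "form (U (K k)) (indicator {z}) = wired_conductance (K k) * ?d"
        by (rule repr[OF K(2), where l=0]) (use elim in \<open>auto simp: indicator_def\<close>)
      moreover have "?r k = form w (indicator {z}) - form (U (K k)) (indicator {z})"
        by (rule form_diff_left[OF fz finw finU[OF K(2)]])
      ultimately show ?case by simp
    qed
    then have "(\<lambda>k. ?r k + wired_conductance (K k) * ?d) \<longlonglongrightarrow> form w (indicator {z})"
      by (rule Lim_transform_eventually[OF tendsto_const])
    moreover have "(\<lambda>k. ?r k + wired_conductance (K k) * ?d) \<longlonglongrightarrow> 0 + wired_limit * ?d"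
      by (intro tendsto_intros r lim)
    ultimately have "form w (indicator {z}) = 0 + wired_limit * ?d" by (rule LIMSEQ_unique)
    then show ?thesis by (simp add: form_indicator[OF finw z])
  qed
  then show ?thesis using that w finw by blast
qed

lemma Harm_trivial_imp_limits_eq:
  assumes "Harm V c = {energy_zero V}"
  shows "free_limit = wired_limit"
proof -
  obtain u where u: "u \<in> unit_functions x y" "fin u"
    "\<And>f. fin f \<Longrightarrow> form u f = free_limit * (f x - f y)"
    by (rule obtain_free_limit_potential) blast
  obtain w where w: "w \<in> unit_functions x y" "fin w"
    "\<And>z. z \<in> V \<Longrightarrow> laplacian V c w z = wired_limit * (indicator {z} x - indicator {z} y)"
    by (rule obtain_wired_limit_potential) blast
  define h where "h = (\<lambda>a. inverse free_limit * u a - inverse wired_limit * w a)"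
  have fin: "fin (\<lambda>a. inverse free_limit * u a)" "fin (\<lambda>a. inverse wired_limit * w a)"
    using u(2) w(2) by (auto intro: fin_scale)
  have fh: "fin h" unfolding h_def using fin by (rule fin_diff)
  have "laplacian V c h z = 0" if z: "z \<in> V" for z
  proof -
    have fz: "fin (indicator {z})" using z by (rule fin_indicator)
    have "laplacian V c h z = form h (indicator {z})" by (rule form_indicator[OF fh z, symmetric])
    also have "\<dots> = inverse free_limit * form u (indicator {z}) - inverse wired_limit * form w (indicator {z})"
      unfolding h_def form_diff_left[OF fz fin] form_scale_left by (rule refl)
    also have "\<dots> = 0"
      unfolding u(3)[OF fz] form_indicator[OF w(2) z] w(3)[OF z]
      using free_limit_pos wired_limit_pos by simp
    finally show ?thesis .
  qed
  with assms fh have "h x = h y" using x y by (rule harmonic_imp_constant)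
  then have "inverse free_limit = inverse wired_limit"
    using u(1) w(1) by (simp add: h_def unit_functions_def)
  then show ?thesis by simp
qed

end

theorem theorem2p29:
  fixes V :: "'a set" and c :: "'a \<Rightarrow> 'a \<Rightarrow> real" and x y :: 'a
  assumes "resistance_network V c" and "infinite V"
    and "x \<in> V" and "y \<in> V" and "x \<noteq> y"
  shows "boundary_resistance V c x y =
           ereal (wired_resistance V c x y * free_resistance V c x y)
             / ereal (harmonic_resistance V c x y) \<and>
         (Harm V c = {energy_zero V} \<longrightarrow> boundary_resistance V c x y = \<infinity>)"
proof -
  interpret resistance_network V c by fact
  interpret vertex_pair V c x y using assms(3-5) by unfold_locales
  let ?F = "free_resistance V c x y" and ?W = "wired_resistance V c x y"
  have F: "0 < ?F" using free_limit_pos by (simp add: free_resistance_eq)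
  have W: "0 < ?W" using wired_limit_pos by (simp add: wired_resistance_eq)
  have "boundary_resistance V c x y = ereal (?W * ?F) / ereal (harmonic_resistance V c x y)"
  proof (cases "?F = ?W")
    case True
    then show ?thesis using W
      by (simp add: boundary_resistance_def harmonic_resistance_def)
  next
    case False
    then have "1 / (inverse ?W - inverse ?F) = ?W * ?F / (?F - ?W)"
      using F W by (simp add: field_simps)
    then show ?thesis using False
      by (simp add: boundary_resistance_def harmonic_resistance_def one_ereal_def)
  qed
  moreover have "boundary_resistance V c x y = \<infinity>" if "Harm V c = {energy_zero V}"
    using Harm_trivial_imp_limits_eq[OF that]
    by (simp add: boundary_resistance_def free_resistance_eq wired_resistance_eq)
  ultimately show ?thesis by blast
qed

end
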